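(* Let $Q_{R,d}$ (for every data $R$ and every $d\in\mathbb{Z}$) and $Q_R$ (for every data $R$) be formal Laurent series in $\mathbb{Q}((x))$ such that for every data $R$ and every $d\in\mathbb{Z}$ $$Q_R(x)=\sum_{r\ge1}\sum_{I:\ \ell(I)=r}\ \sum_{(d_1,\dots,d_r)}x^{N_R(I;d_1,\dots,d_r)}\prod_{k=1}^rQ_{R^I_k,d_k}(x),$$ where $I$ runs over partitions of $R$ of length $r$ and $(d_1,\dots,d_r)$ over $\mathbb{Z}^r$ with $\sum_id_i=d$ and $\frac{d_1+\alpha(R^I_1)}{n(R^I_1)}>\dots>\frac{d_r+\alpha(R^I_r)}{n(R^I_r)}$. Then for every $R$ and $d$, $$Q_{R,d}(x)=\sum_{r\ge1}\sum_{I:\ \ell(I)=r}\frac{x^{M'_R(I;d)+M_R(I;(d+\alpha(R))/n(R))}}{(x^{n(R^I_1)+n(R^I_2)}-1)\cdots(x^{n(R^I_{r-1})+n(R^I_r)}-1)}\prod_{k=1}^rQ_{R^I_k}(x).$$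
   Context: Fix a finite set $S$, integers $m_P\ge1$ ($P\in S$) and reals $0\le\alpha^P_1<\dots<\alpha^P_{m_P}<1$. A data $R=(R^P_i)_{P\in S,1\le i\le m_P}$ is a family of non-negative integers with $n(R)=\sum_iR^P_i$ positive and independent of $P$; $\alpha(R)=\sum_P\sum_iR^P_i\alpha^P_i$. A partition of $R$ of length $r=\ell(I)$ is a family of non-negative integers $I=(I^P_{i,k})$, $1\le k\le r$, with $\sum_kI^P_{i,k}=R^P_i$, $\sum_iI^P_{i,k}$ independent of $P$, and for each $k$ some $I^P_{i,k}\ne0$. Let $R^I_k$ and $R^I_{\le k}$ be the data $(R^I_k)^P_i=I^P_{i,k}$, $(R^I_{\le k})^P_i=\sum_{k'\le k}I^P_{i,k'}$. Define $N_R(I;d_1,\dots,d_r)=\sum_{k>l}(d_ln(R^I_k)-d_kn(R^I_l))-\sigma_R(I)$ with $\sigma_R(I)=\sum_{P\in S}\sum_{k>l,\ i>t}I^P_{i,k}I^P_{t,l}$; $M'_R(I;d)=-(n(R)-n(R^I_r))d-\sigma_R(I)+(2n(R)-n(R^I_1)-n(R^I_r))$; $M_R(I;\lambda)=\sum_{k=1}^{r-1}(n(R^I_k)+n(R^I_{k+1}))\,[\,n(R^I_{\le k})\lambda-\alpha(R^I_{\le k})\,]$ for $\lambda\in\mathbb{R}$, where $[y]$ is the largest integer $\le y$. The factors $1/(x^a-1)$ are expanded in $\mathbb{Q}((x))$. *)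

theory Defs
  imports "HOL-Analysis.Infinite_Sum" "HOL-Computational_Algebra.Formal_Laurent_Series"
begin

text \<open>Parameters: a finite set S of points (type 'p), m :: 'p \<Rightarrow> nat, weights
  al :: 'p \<Rightarrow> nat \<Rightarrow> real (al P i = alpha^P_i for 1 \<le> i \<le> m P).
  A datum R is a function 'p \<Rightarrow> nat \<Rightarrow> nat, R P i = R^P_i for P \<in> S, 1 \<le> i \<le> m P,
  and 0 elsewhere.\<close>

definition weights_ok :: "'p set \<Rightarrow> ('p \<Rightarrow> nat) \<Rightarrow> ('p \<Rightarrow> nat \<Rightarrow> real) \<Rightarrow> bool" where
  "weights_ok S m al \<longleftrightarrow>
     (\<forall>P\<in>S. 1 \<le> m P \<and> 0 \<le> al P 1 \<and> al P (m P) < 1 \<and>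
        (\<forall>i j. 1 \<le> i \<longrightarrow> i < j \<longrightarrow> j \<le> m P \<longrightarrow> al P i < al P j))"

definition rank_at :: "('p \<Rightarrow> nat) \<Rightarrow> ('p \<Rightarrow> nat \<Rightarrow> nat) \<Rightarrow> 'p \<Rightarrow> nat" where
  "rank_at m R P = (\<Sum>i=1..m P. R P i)"

definition is_data :: "'p set \<Rightarrow> ('p \<Rightarrow> nat) \<Rightarrow> ('p \<Rightarrow> nat \<Rightarrow> nat) \<Rightarrow> bool" where
  "is_data S m R \<longleftrightarrow>
     (\<forall>P i. (P \<notin> S \<or> i < 1 \<or> m P < i) \<longrightarrow> R P i = 0) \<and>
     (\<exists>n>0. \<forall>P\<in>S. rank_at m R P = n)"

text \<open>n(R) (independent of P for data; S is assumed nonempty)\<close>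
definition data_n :: "'p set \<Rightarrow> ('p \<Rightarrow> nat) \<Rightarrow> ('p \<Rightarrow> nat \<Rightarrow> nat) \<Rightarrow> nat" where
  "data_n S m R = rank_at m R (SOME P. P \<in> S)"

definition data_alpha :: "'p set \<Rightarrow> ('p \<Rightarrow> nat) \<Rightarrow> ('p \<Rightarrow> nat \<Rightarrow> real) \<Rightarrow> ('p \<Rightarrow> nat \<Rightarrow> nat) \<Rightarrow> real" where
  "data_alpha S m al R = (\<Sum>P\<in>S. \<Sum>i=1..m P. real (R P i) * al P i)"

definition is_partition ::
  "'p set \<Rightarrow> ('p \<Rightarrow> nat) \<Rightarrow> ('p \<Rightarrow> nat \<Rightarrow> nat) \<Rightarrow> nat \<Rightarrow> ('p \<Rightarrow> nat \<Rightarrow> nat \<Rightarrow> nat) \<Rightarrow> bool" where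
  "is_partition S m R r I \<longleftrightarrow>
     (\<forall>P i k. (P \<notin> S \<or> i < 1 \<or> m P < i \<or> k < 1 \<or> r < k) \<longrightarrow> I P i k = 0) \<and>
     (\<forall>P\<in>S. \<forall>i\<in>{1..m P}. (\<Sum>k=1..r. I P i k) = R P i) \<and>
     (\<forall>k\<in>{1..r}. \<exists>c. \<forall>P\<in>S. (\<Sum>i=1..m P. I P i k) = c) \<and>
     (\<forall>k\<in>{1..r}. \<exists>P\<in>S. \<exists>i\<in>{1..m P}. I P i k \<noteq> 0)"

definition part_k :: "('p \<Rightarrow> nat \<Rightarrow> nat \<Rightarrow> nat) \<Rightarrow> nat \<Rightarrow> ('p \<Rightarrow> nat \<Rightarrow> nat)" where
  "part_k I k = (\<lambda>P i. I P i k)"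

definition part_le :: "('p \<Rightarrow> nat \<Rightarrow> nat \<Rightarrow> nat) \<Rightarrow> nat \<Rightarrow> ('p \<Rightarrow> nat \<Rightarrow> nat)" where
  "part_le I k = (\<lambda>P i. \<Sum>k'=1..k. I P i k')"

definition sigma_R :: "'p set \<Rightarrow> ('p \<Rightarrow> nat) \<Rightarrow> nat \<Rightarrow> ('p \<Rightarrow> nat \<Rightarrow> nat \<Rightarrow> nat) \<Rightarrow> int" where
  "sigma_R S m r I =
     (\<Sum>P\<in>S. \<Sum>k=1..r. \<Sum>l=1..r. \<Sum>i=1..m P. \<Sum>t=1..m P.
        if k > l \<and> i > t then int (I P i k * I P t l) else 0)"

definition N_R :: "'p set \<Rightarrow> ('p \<Rightarrow> nat) \<Rightarrow> nat \<Rightarrow> ('p \<Rightarrow> nat \<Rightarrow> nat \<Rightarrow> nat) \<Rightarrow> (nat \<Rightarrow> int) \<Rightarrow> int" where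
  "N_R S m r I ds =
     (\<Sum>k=1..r. \<Sum>l=1..r. if k > l then
        ds l * int (data_n S m (part_k I k)) - ds k * int (data_n S m (part_k I l)) else 0)
     - sigma_R S m r I"

definition M'_R :: "'p set \<Rightarrow> ('p \<Rightarrow> nat) \<Rightarrow> ('p \<Rightarrow> nat \<Rightarrow> nat) \<Rightarrow> nat \<Rightarrow> ('p \<Rightarrow> nat \<Rightarrow> nat \<Rightarrow> nat) \<Rightarrow> int \<Rightarrow> int" where
  "M'_R S m R r I d =
     - (int (data_n S m R) - int (data_n S m (part_k I r))) * d - sigma_R S m r I
     + (2 * int (data_n S m R) - int (data_n S m (part_k I 1)) - int (data_n S m (part_k I r)))"

definition M_R :: "'p set \<Rightarrow> ('p \<Rightarrow> nat) \<Rightarrow> ('p \<Rightarrow> nat \<Rightarrow> real) \<Rightarrow> nat \<Rightarrow> ('p \<Rightarrow> nat \<Rightarrow> nat \<Rightarrow> nat) \<Rightarrow> real \<Rightarrow> int" where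
  "M_R S m al r I lam =
     (\<Sum>k=1..r-1. int (data_n S m (part_k I k) + data_n S m (part_k I (k+1))) *
        \<lfloor>real (data_n S m (part_le I k)) * lam - data_alpha S m al (part_le I k)\<rfloor>)"

definition hyp_index ::
  "'p set \<Rightarrow> ('p \<Rightarrow> nat) \<Rightarrow> ('p \<Rightarrow> nat \<Rightarrow> real) \<Rightarrow> ('p \<Rightarrow> nat \<Rightarrow> nat) \<Rightarrow> int
     \<Rightarrow> (nat \<times> ('p \<Rightarrow> nat \<Rightarrow> nat \<Rightarrow> nat) \<times> (nat \<Rightarrow> int)) set" where
  "hyp_index S m al R d =
     {(r, I, ds). r \<ge> 1 \<and> is_partition S m R r I \<and>
        (\<forall>k. (k < 1 \<or> r < k) \<longrightarrow> ds k = 0) \<and>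
        (\<Sum>k=1..r. ds k) = d \<and>
        (\<forall>k\<in>{1..<r}.
           (real_of_int (ds k) + data_alpha S m al (part_k I k)) / real (data_n S m (part_k I k)) >
           (real_of_int (ds (k+1)) + data_alpha S m al (part_k I (k+1))) / real (data_n S m (part_k I (k+1))))}"

definition part_index ::
  "'p set \<Rightarrow> ('p \<Rightarrow> nat) \<Rightarrow> ('p \<Rightarrow> nat \<Rightarrow> nat) \<Rightarrow> (nat \<times> ('p \<Rightarrow> nat \<Rightarrow> nat \<Rightarrow> nat)) set" where
  "part_index S m R = {(r, I). r \<ge> 1 \<and> is_partition S m R r I}"

end

theory Submission
  imports Defs "HOL-Library.Function_Algebras"
begin

text \<open>Summing the geometric series turns the right-hand side into
  \<open>\<Sum> (-1)\<^sup>r\<^sup>-\<^sup>1 x\<^bsup>N(I;d\<^sub>1,\<dots>,d\<^sub>r)\<^esup> Q\<^bsub>R\<^sub>1\<^esub> \<cdots> Q\<^bsub>R\<^sub>r\<^esub>\<close>, the sum running over all lists of pairs \<open>(R\<^sub>k, d\<^sub>k)\<close> with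
  total \<open>(R, d)\<close> whose proper initial segments all have slope larger than the total slope.
  The series \<open>Q\<^bsub>R\<^sub>k\<^esub>\<close> does not depend on a degree, so it may be expanded by the hypothesis in
  degree \<open>d\<^sub>k\<close>. Since \<open>N\<close> is a sum of a biadditive form over the ordered pairs of entries, the result is
  a sum over lists \<open>zs\<close> of total \<open>(R, d)\<close> of \<open>x\<^bsup>N(zs)\<^esup> \<Prod> Q\<^bsub>z\<^esub>\<close>, with coefficient the signed number of ways
  to cut \<open>zs\<close> into blocks of decreasing slope such that every proper cut point lies strictly above
  the total slope. This number is a product over the gaps of \<open>zs\<close>. It is nonzero only if the
  strictly concave vertices of the polygonal path of \<open>zs\<close> are exactly those not above its chord, and no
  path with an interior vertex has this property. Hence only the singleton \<open>zs = [(R, d)]\<close> survives.\<close>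

text \<open>Expanding every \<open>Q\<close> inside an infinite sum gives a double family, and
  reordering it is legitimate only if, for each N, all but finitely many of its terms have order at
  least N. The outer exponents tend to infinity, but each expanded factor may have a pole while its
  degree runs through all integers. So the order of \<open>Qd (g, d)\<close> has to be bounded below
  independently of d. The hypothesis itself yields such a bound by induction on the rank:
  \<open>Q R\<close> is one series for all d, terms with several factors involve smaller ranks only,
  and on lists of decreasing slope the exponent is bounded below in terms of the data alone. The
  closed form comes from a change of coordinates. In the degrees e_k of the initial segments, N is
  linear with coefficient a = n(R_k) + n(R_{k+1}) at e_k, and the slope conditions become
  independent bounds e_k > E with E a floor. Each coordinate thus gives the sum of x^(a e) over e >
  E, which is -x^(a(E+1))/(x^a - 1). The minus signs form (-1)^(r-1), and the shifts from E to E + 1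
  add up to 2n(R) - n(R_1) - n(R_r).\<close>

unbundle fps_syntax

section \<open>Summable families of Laurent series\<close>

text \<open>Phrased by coefficients because \<open>fls_subdegree\<close> is 0 at the zero series,
  whereas the zero series has to satisfy every lower bound.\<close>

definition fls_ge :: "int \<Rightarrow> 'a::zero fls \<Rightarrow> bool" where
  "fls_ge c f \<longleftrightarrow> (\<forall>k<c. f $$ k = 0)"

lemma fls_ge_mono: "fls_ge c f \<Longrightarrow> c' \<le> c \<Longrightarrow> fls_ge c' f"
  by (auto simp: fls_ge_def)

lemma fls_ge_0 [simp]: "fls_ge c 0"
  by (simp add: fls_ge_def)

lemma fls_ge_add: "fls_ge c f \<Longrightarrow> fls_ge c g \<Longrightarrow> fls_ge c (f + g)"
  for f :: "'a::monoid_add fls"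
  by (simp add: fls_ge_def)

lemma fls_ge_diff: "fls_ge c f \<Longrightarrow> fls_ge c g \<Longrightarrow> fls_ge c (f - g)"
  for f :: "'a::group_add fls"
  by (simp add: fls_ge_def)

lemma fls_ge_sum: "(\<And>x. x \<in> A \<Longrightarrow> fls_ge c (f x)) \<Longrightarrow> fls_ge c (\<Sum>x\<in>A. f x)"
  for f :: "_ \<Rightarrow> 'a::comm_monoid_add fls"
  by (simp add: fls_ge_def fls_nth_sum)

lemma fls_ge_iff_subdegree: "fls_ge c f \<longleftrightarrow> f = 0 \<or> c \<le> fls_subdegree f"
  using nth_fls_subdegree_nonzero[of f]
  by (auto simp: fls_ge_def intro: fls_subdegree_geI)

lemma ex_fls_ge: "\<exists>c. fls_ge c f"
  by (auto simp: fls_ge_iff_subdegree)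

lemma fls_ge_mult:
  fixes f g :: "'a::{comm_monoid_add,mult_zero} fls"
  assumes "fls_ge c f" "fls_ge c' g"
  shows "fls_ge (c + c') (f * g)"
proof (cases "f * g = 0")
  case False
  then have "f \<noteq> 0" "g \<noteq> 0" by auto
  with assms fls_mult_subdegree_ge[OF False] show ?thesis
    by (auto simp: fls_ge_iff_subdegree)
qed simp

lemma fls_ge_X_intpow [simp]: "fls_ge c (fls_X_intpow i :: 'a::zero_neq_one fls) \<longleftrightarrow> c \<le> i"
  unfolding fls_ge_iff_subdegree by simp

lemma fls_ge_1: "c \<le> 0 \<Longrightarrow> fls_ge c (1 :: 'a::zero_neq_one fls)"
  unfolding fls_ge_iff_subdegree by simp

lemma fls_ge_prod_list:
  fixes fs :: "'a::{comm_semiring_1} fls list"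
  assumes "\<And>f. f \<in> set fs \<Longrightarrow> fls_ge c f"
  shows "fls_ge (int (length fs) * c) (prod_list fs)"
  using assms
proof (induction fs)
  case (Cons f fs)
  have "fls_ge (c + int (length fs) * c) (f * prod_list fs)"
    by (rule fls_ge_mult) (use Cons in auto)
  moreover have "c + int (length fs) * c = int (length (f # fs)) * c"
    by (simp add: ring_distribs)
  ultimately show ?case by simp
qed (simp add: fls_ge_1)

lemma fls_eq_0_if_ge: "(\<And>N. fls_ge N f) \<Longrightarrow> f = 0"
proof (rule fls_eqI)
  fix k
  assume "\<And>N. fls_ge N f"
  from this[of "k + 1"] show "f $$ k = 0 $$ k" by (simp add: fls_ge_def)
qed

text \<open>Convergence of a family of Laurent series in the \<open>X\<close>-adic topology, stated algebraically
  because the library does not equip \<open>fls\<close> with the topological group structure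
  on which the rearrangement theorems for \<open>has_sum\<close> depend.\<close>

definition fls_sums :: "('i \<Rightarrow> 'a::ab_group_add fls) \<Rightarrow> 'i set \<Rightarrow> 'a fls \<Rightarrow> bool" where
  "fls_sums f A s \<longleftrightarrow>
     (\<forall>N. \<exists>F. finite F \<and> F \<subseteq> A \<and> (\<forall>F'. finite F' \<longrightarrow> F \<subseteq> F' \<longrightarrow> F' \<subseteq> A \<longrightarrow> fls_ge N (s - sum f F')))"

text \<open>The metric is non-archimedean, so this is the summability condition itself. Verifying it
  for a double family is what licenses a change in the order of summation.\<close>

definition fls_null_family :: "('i \<Rightarrow> 'a::zero fls) \<Rightarrow> 'i set \<Rightarrow> bool" where
  "fls_null_family f A \<longleftrightarrow> (\<forall>N. finite {a \<in> A. \<not> fls_ge N (f a)})"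

lemma fls_sumsE:
  assumes "fls_sums f A s"
  obtains F where "finite F" "F \<subseteq> A"
    "\<And>F'. finite F' \<Longrightarrow> F \<subseteq> F' \<Longrightarrow> F' \<subseteq> A \<Longrightarrow> fls_ge N (s - sum f F')"
proof -
  from assms obtain F where "finite F \<and> F \<subseteq> A \<and>
      (\<forall>F'. finite F' \<longrightarrow> F \<subseteq> F' \<longrightarrow> F' \<subseteq> A \<longrightarrow> fls_ge N (s - sum f F'))"
    unfolding fls_sums_def by (elim allE[of _ N] exE)
  then show thesis by (intro that[of F]) simp_all
qed

lemma fls_sums_imp_null_family:
  assumes "fls_sums f A s"
  shows "fls_null_family f A"
  unfolding fls_null_family_def
proof
  fix N
  from assms obtain F where F: "finite F" "F \<subseteq> A"
    "\<And>F'. finite F' \<Longrightarrow> F \<subseteq> F' \<Longrightarrow> F' \<subseteq> A \<Longrightarrow> fls_ge N (s - sum f F')"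
    by (rule fls_sumsE[where N = N]) (rule that; simp)
  have "fls_ge N (f a)" if "a \<in> A" "a \<notin> F" for a
  proof -
    have "fls_ge N ((s - sum f F) - (s - sum f (insert a F)))"
      by (intro fls_ge_diff F) (use F that in auto)
    then show ?thesis using F that by (simp add: algebra_simps)
  qed
  then have "{a \<in> A. \<not> fls_ge N (f a)} \<subseteq> F" by auto
  then show "finite {a \<in> A. \<not> fls_ge N (f a)}" using F finite_subset by blast
qed

lemma fls_null_family_bounded:
  assumes "fls_null_family f A"
  shows "\<exists>c. \<forall>a\<in>A. fls_ge c (f a)"
proof -
  define F where "F = {a \<in> A. \<not> fls_ge 0 (f a)}"
  have "finite F" using assms by (auto simp: fls_null_family_def F_def)
  define c where "c = Min (insert 0 ((\<lambda>a. fls_subdegree (f a)) ` F))"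
  have "c \<le> 0" "\<And>a. a \<in> F \<Longrightarrow> c \<le> fls_subdegree (f a)"
    using \<open>finite F\<close> by (auto simp: c_def)
  then have "\<forall>a\<in>A. fls_ge c (f a)"
    by (metis (mono_tags, lifting) F_def fls_ge_iff_subdegree fls_ge_mono mem_Collect_eq)
  then show ?thesis ..
qed

text \<open>Adding or removing terms of order at least N does not change a sum modulo x^N. Hence
  every finite set that contains the finitely many other terms is already a witness for precision
  N.\<close>

lemma fls_sums_iff_null_family:
  "fls_sums f A s \<longleftrightarrow> fls_null_family f A \<and>
     (\<forall>N F. finite F \<longrightarrow> F \<subseteq> A \<longrightarrow> {a \<in> A. \<not> fls_ge N (f a)} \<subseteq> F \<longrightarrow> fls_ge N (s - sum f F))"
  (is "?L \<longleftrightarrow> ?R")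
proof
  assume L: ?L
  show ?R
  proof (intro conjI fls_sums_imp_null_family[OF L] allI impI)
    fix N F assume F: "finite F" "F \<subseteq> A" "{a \<in> A. \<not> fls_ge N (f a)} \<subseteq> F"
    from L obtain G where G: "finite G" "G \<subseteq> A"
      "\<And>F'. finite F' \<Longrightarrow> G \<subseteq> F' \<Longrightarrow> F' \<subseteq> A \<Longrightarrow> fls_ge N (s - sum f F')"
      by (rule fls_sumsE[where N = N]) (rule that; simp)
    have "sum f (F \<union> G) = sum f F + sum f (G - F)"
      using F G sum.union_disjoint[of F "G - F" f] by simp
    moreover have "fls_ge N (s - sum f (F \<union> G))" using F G by auto
    moreover have "fls_ge N (sum f (G - F))" using F G by (intro fls_ge_sum) auto
    ultimately have "fls_ge N ((s - sum f F - sum f (G - F)) + sum f (G - F))"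
      by (intro fls_ge_add) (simp_all add: algebra_simps)
    then show "fls_ge N (s - sum f F)" by simp
  qed
next
  assume R: ?R
  show ?L unfolding fls_sums_def
  proof
    fix N
    show "\<exists>F. finite F \<and> F \<subseteq> A \<and> (\<forall>F'. finite F' \<longrightarrow> F \<subseteq> F' \<longrightarrow> F' \<subseteq> A \<longrightarrow> fls_ge N (s - sum f F'))"
      by (rule exI[of _ "{a \<in> A. \<not> fls_ge N (f a)}"]) (use R in \<open>auto simp: fls_null_family_def\<close>)
  qed
qed

lemma fls_sums_unique:
  assumes "fls_sums f A s" "fls_sums f A t"
  shows "s = t"
proof -
  have "fls_ge N (s - t)" for N
  proof -
    let ?F = "{a \<in> A. \<not> fls_ge N (f a)}"
    have "finite ?F" using fls_sums_imp_null_family[OF assms(1)] by (simp add: fls_null_family_def)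
    then have "fls_ge N (s - sum f ?F)" "fls_ge N (t - sum f ?F)"
      using assms by (simp_all add: fls_sums_iff_null_family)
    then have "fls_ge N ((s - sum f ?F) - (t - sum f ?F))"
      by (rule fls_ge_diff)
    then show ?thesis by (simp add: algebra_simps)
  qed
  from fls_eq_0_if_ge[OF this] show ?thesis by simp
qed

lemma fls_sums_finite_support:
  assumes "finite F" "F \<subseteq> A" "\<And>a. a \<in> A - F \<Longrightarrow> f a = 0"
  shows "fls_sums f A (sum f F)"
  unfolding fls_sums_def
proof (intro allI exI[of _ F] conjI impI)
  fix N F' assume F': "finite F'" "F \<subseteq> F'" "F' \<subseteq> A"
  have "sum f F' = sum f F" using assms F' by (intro sum.mono_neutral_right) auto
  then show "fls_ge N (sum f F - sum f F')" by simp
qed (use assms in auto)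

lemma fls_sums_finite: "finite A \<Longrightarrow> fls_sums f A (sum f A)"
  by (rule fls_sums_finite_support) auto

lemma fls_sums_reindex:
  assumes "inj_on h A"
  shows "fls_sums f (h ` A) s \<longleftrightarrow> fls_sums (f \<circ> h) A s"
proof
  assume L: "fls_sums f (h ` A) s"
  show "fls_sums (f \<circ> h) A s" unfolding fls_sums_def
  proof
    fix N
    from L obtain F where F: "finite F" "F \<subseteq> h ` A"
      "\<And>F'. finite F' \<Longrightarrow> F \<subseteq> F' \<Longrightarrow> F' \<subseteq> h ` A \<Longrightarrow> fls_ge N (s - sum f F')"
      by (rule fls_sumsE[where N = N]) (rule that; simp)
    from F obtain G where G: "G \<subseteq> A" "finite G" "F = h ` G"
      by (meson finite_subset_image)
    show "\<exists>F. finite F \<and> F \<subseteq> A \<and>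
      (\<forall>F'. finite F' \<longrightarrow> F \<subseteq> F' \<longrightarrow> F' \<subseteq> A \<longrightarrow> fls_ge N (s - sum (f \<circ> h) F'))"
    proof (intro exI[of _ G] conjI allI impI)
      fix F' assume F': "finite F'" "G \<subseteq> F'" "F' \<subseteq> A"
      then have "sum (f \<circ> h) F' = sum f (h ` F')"
        using assms by (simp add: sum.reindex inj_on_subset)
      then show "fls_ge N (s - sum (f \<circ> h) F')" using F' F(3)[of "h ` F'"] G by auto
    qed (use G in auto)
  qed
next
  assume R: "fls_sums (f \<circ> h) A s"
  show "fls_sums f (h ` A) s" unfolding fls_sums_def
  proof
    fix N
    from R obtain F where F: "finite F" "F \<subseteq> A"
      "\<And>F'. finite F' \<Longrightarrow> F \<subseteq> F' \<Longrightarrow> F' \<subseteq> A \<Longrightarrow> fls_ge N (s - sum (f \<circ> h) F')"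
      by (rule fls_sumsE[where N = N]) (rule that; simp)
    show "\<exists>F. finite F \<and> F \<subseteq> h ` A \<and>
      (\<forall>F'. finite F' \<longrightarrow> F \<subseteq> F' \<longrightarrow> F' \<subseteq> h ` A \<longrightarrow> fls_ge N (s - sum f F'))"
    proof (intro exI[of _ "h ` F"] conjI allI impI)
      fix F' assume F': "finite F'" "h ` F \<subseteq> F'" "F' \<subseteq> h ` A"
      define G where "G = {a \<in> A. h a \<in> F'}"
      have G: "F' = h ` G" "G \<subseteq> A" "F \<subseteq> G" using F' F by (auto simp: G_def)
      have "inj_on h G" using assms G inj_on_subset by blast
      moreover from this have "finite G" using F' G finite_imageD by blast
      ultimately show "fls_ge N (s - sum f F')" using F(3)[of G] G by (simp add: sum.reindex)
    qed (use F in auto)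
  qed
qed

lemma fls_sums_cong:
  assumes "\<And>a. a \<in> A \<Longrightarrow> f a = g a"
  shows "fls_sums f A s \<longleftrightarrow> fls_sums g A s"
proof -
  have "sum f F = sum g F" if "F \<subseteq> A" for F
    using that assms by (intro sum.cong) auto
  then show ?thesis by (simp add: fls_sums_def cong: conj_cong imp_cong)
qed

lemma fls_sums_bij_betw:
  assumes "bij_betw h A B" "\<And>a. a \<in> A \<Longrightarrow> g a = f (h a)"
  shows "fls_sums f B s \<longleftrightarrow> fls_sums g A s"
proof -
  have "fls_sums f B s \<longleftrightarrow> fls_sums (f \<circ> h) A s"
    using assms fls_sums_reindex by (metis bij_betw_def)
  also have "\<dots> \<longleftrightarrow> fls_sums g A s"
    using assms by (intro fls_sums_cong) auto
  finally show ?thesis .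
qed

lemma fls_sums_times:
  fixes f :: "'i \<Rightarrow> 'a::comm_ring_1 fls"
  assumes "fls_sums f A s" "fls_sums g B t"
  shows "fls_sums (\<lambda>(a, b). f a * g b) (A \<times> B) (s * t)"
proof -
  have nf: "fls_null_family f A" and ng: "fls_null_family g B"
    using assms fls_sums_imp_null_family by blast+
  obtain cf where cf: "\<And>a. a \<in> A \<Longrightarrow> fls_ge cf (f a)" using fls_null_family_bounded[OF nf] by auto
  obtain cg where cg: "\<And>b. b \<in> B \<Longrightarrow> fls_ge cg (g b)" using fls_null_family_bounded[OF ng] by auto
  obtain ct where ct: "fls_ge ct t" using ex_fls_ge by blast
  show ?thesis unfolding fls_sums_iff_null_family
  proof
    show "fls_null_family (\<lambda>(a, b). f a * g b) (A \<times> B)"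
      unfolding fls_null_family_def
    proof
      fix N
      let ?F = "{a \<in> A. \<not> fls_ge (N - cg) (f a)}" and ?G = "{b \<in> B. \<not> fls_ge (N - cf) (g b)}"
      have "fls_ge N (f a * g b)" if "a \<in> A" "b \<in> B" "fls_ge (N - cg) (f a) \<or> fls_ge (N - cf) (g b)" for a b
        using that fls_ge_mult[of "N - cg" "f a" cg "g b"] fls_ge_mult[of cf "f a" "N - cf" "g b"] cf cg
        by auto
      then have "{p \<in> A \<times> B. \<not> fls_ge N (case p of (a, b) \<Rightarrow> f a * g b)} \<subseteq> ?F \<times> ?G" by auto
      moreover have "finite (?F \<times> ?G)" using nf ng by (auto simp: fls_null_family_def)
      ultimately show "finite {p \<in> A \<times> B. \<not> fls_ge N (case p of (a, b) \<Rightarrow> f a * g b)}"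
        using finite_subset by blast
    qed
    note null = this
    show "\<forall>N F. finite F \<longrightarrow> F \<subseteq> A \<times> B \<longrightarrow>
        {p \<in> A \<times> B. \<not> fls_ge N (case p of (a, b) \<Rightarrow> f a * g b)} \<subseteq> F \<longrightarrow>
        fls_ge N (s * t - (\<Sum>(a, b)\<in>F. f a * g b))"
    proof (intro allI impI)
      fix N F assume F: "finite F" "F \<subseteq> A \<times> B"
        "{p \<in> A \<times> B. \<not> fls_ge N (case p of (a, b) \<Rightarrow> f a * g b)} \<subseteq> F"
      \<comment> \<open>The precisions are chosen for the splitting (s - sum f) * t + sum f * (t -
        sum g), where t has order at least \<open>ct\<close> and sum f at least \<open>cf\<close>.
        The projections of F are added so that F lies inside \<open>F1 \<times> F2\<close>; the
        pairs outside F have order at least N.\<close>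
      define F1 where "F1 = {a \<in> A. \<not> fls_ge (N - ct) (f a)} \<union> fst ` F"
      define F2 where "F2 = {b \<in> B. \<not> fls_ge (N - cf) (g b)} \<union> snd ` F"
      have fin: "finite F1" "finite F2" "F1 \<subseteq> A" "F2 \<subseteq> B"
        using nf ng F by (auto simp: fls_null_family_def F1_def F2_def)
      have "fls_ge (N - ct) (s - sum f F1)" "fls_ge (N - cf) (t - sum g F2)"
        using assms fin by (auto simp: fls_sums_iff_null_family F1_def F2_def)
      moreover have "fls_ge cf (sum f F1)" using cf fin by (intro fls_ge_sum) auto
      ultimately have "fls_ge N ((s - sum f F1) * t + sum f F1 * (t - sum g F2))"
        using ct fls_ge_mult[of "N - ct" "s - sum f F1" ct t]
          fls_ge_mult[of cf "sum f F1" "N - cf" "t - sum g F2"]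
        by (intro fls_ge_add) auto
      then have 1: "fls_ge N (s * t - sum f F1 * sum g F2)" by (simp add: algebra_simps)
      have sub: "F \<subseteq> F1 \<times> F2" by (force simp: F1_def F2_def)
      have "sum f F1 * sum g F2 = (\<Sum>(a, b)\<in>F1 \<times> F2. f a * g b)"
        by (simp add: sum_product sum.cartesian_product)
      also have "\<dots> = (\<Sum>(a, b)\<in>F. f a * g b) + (\<Sum>(a, b)\<in>F1 \<times> F2 - F. f a * g b)"
        using fin sub by (subst sum.subset_diff[of F]) (auto simp: add.commute)
      finally have 2: "sum f F1 * sum g F2 - (\<Sum>(a, b)\<in>F1 \<times> F2 - F. f a * g b) = (\<Sum>(a, b)\<in>F. f a * g b)"
        by simp
      have "fls_ge N (\<Sum>(a, b)\<in>F1 \<times> F2 - F. f a * g b)"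
      proof (rule fls_ge_sum)
        fix p assume "p \<in> F1 \<times> F2 - F"
        then show "fls_ge N (case p of (a, b) \<Rightarrow> f a * g b)" using F(3) fin by blast
      qed
      from fls_ge_add[OF 1 this] show "fls_ge N (s * t - (\<Sum>(a, b)\<in>F. f a * g b))"
        unfolding 2[symmetric] by (simp add: algebra_simps)
    qed
  qed
qed

lemma fls_sums_cmult:
  fixes f :: "'i \<Rightarrow> 'a::comm_ring_1 fls"
  assumes "fls_sums f A s"
  shows "fls_sums (\<lambda>a. c * f a) A (c * s)"
proof -
  have "fls_sums (\<lambda>(u, a). c * f a) ({()} \<times> A) (c * s)"
    using fls_sums_times[OF fls_sums_finite[of "{()}" "\<lambda>_. c"] assms] by simp
  moreover have "bij_betw (\<lambda>a. ((), a)) A ({()} \<times> A)"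
    by (auto simp: bij_betw_def inj_on_def)
  ultimately show ?thesis by (subst (asm) fls_sums_bij_betw) auto
qed

lemma fls_sums_list_prod:
  fixes f :: "'j \<Rightarrow> 'i \<Rightarrow> 'a::comm_ring_1 fls"
  assumes "\<And>y. y \<in> set ys \<Longrightarrow> fls_sums (f y) (A y) (s y)"
  shows "fls_sums (\<lambda>as. prod_list (map2 f ys as)) {as. list_all2 (\<lambda>y a. a \<in> A y) ys as}
    (prod_list (map s ys))"
  using assms
proof (induction ys)
  case Nil
  have "{as. list_all2 (\<lambda>y a. a \<in> A y) [] as} = {[]}" by auto
  then show ?case using fls_sums_finite[of "{[]}" "\<lambda>as. prod_list (map2 f [] as)"] by simp
next
  case (Cons y ys)
  let ?B = "{as. list_all2 (\<lambda>y a. a \<in> A y) ys as}"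
  have "fls_sums (\<lambda>(a, as). f y a * prod_list (map2 f ys as)) (A y \<times> ?B) (s y * prod_list (map s ys))"
    using Cons by (intro fls_sums_times) auto
  moreover have "bij_betw (\<lambda>(a, as). a # as) (A y \<times> ?B) {as. list_all2 (\<lambda>y a. a \<in> A y) (y # ys) as}"
    by (auto simp: bij_betw_def inj_on_def list_all2_Cons1 image_iff)
  ultimately show ?case
    by (subst fls_sums_bij_betw[of "\<lambda>(a, as). a # as", where g = "\<lambda>(a, as). f y a * prod_list (map2 f ys as)"])
      (auto simp: case_prod_unfold)
qed

text \<open>Iterated convergence does not control the double family, since terms of low order may
  cancel inside infinitely many inner sums. Therefore \<open>null\<close> is a separate
  hypothesis.\<close>

lemma fls_sums_Sigma:
  assumes s: "fls_sums f A s"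
    and g: "\<And>a. a \<in> A \<Longrightarrow> fls_sums (g a) (B a) (f a)"
    and null: "fls_null_family (\<lambda>(a, b). g a b) (Sigma A B)"
  shows "fls_sums (\<lambda>(a, b). g a b) (Sigma A B) s"
  unfolding fls_sums_iff_null_family
proof (intro conjI null allI impI)
  fix N F assume F: "finite F" "F \<subseteq> Sigma A B"
    "{p \<in> Sigma A B. \<not> fls_ge N (case p of (a, b) \<Rightarrow> g a b)} \<subseteq> F"
  \<comment> \<open>Including the projection of F makes F equal to \<open>Sigma A' B'\<close>, with
    an empty fibre over those indices that enter only through the first set.\<close>
  define A' where "A' = {a \<in> A. \<not> fls_ge N (f a)} \<union> fst ` F"
  define B' where "B' a = Pair a -` F" for a
  have "finite A'" "A' \<subseteq> A"
    using F s by (auto simp: A'_def fls_sums_iff_null_family fls_null_family_def)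
  have FA: "F = Sigma A' B'" by (force simp: A'_def B'_def)
  have B': "finite (B' a)" "B' a \<subseteq> B a" "{b \<in> B a. \<not> fls_ge N (g a b)} \<subseteq> B' a" if "a \<in> A" for a
    using F that by (auto simp: B'_def inj_on_def intro!: finite_vimageI)
  have "fls_ge N ((s - sum f A') + (\<Sum>a\<in>A'. f a - sum (g a) (B' a)))"
  proof (intro fls_ge_add fls_ge_sum)
    show "fls_ge N (s - sum f A')"
      using s \<open>finite A'\<close> \<open>A' \<subseteq> A\<close> by (auto simp: fls_sums_iff_null_family A'_def)
    show "fls_ge N (f a - sum (g a) (B' a))" if "a \<in> A'" for a
      using g[of a] B'[of a] that \<open>A' \<subseteq> A\<close> by (auto simp: fls_sums_iff_null_family)
  qed
  moreover have "(\<Sum>(a, b)\<in>F. g a b) = (\<Sum>a\<in>A'. sum (g a) (B' a))"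
    unfolding FA using \<open>finite A'\<close> \<open>A' \<subseteq> A\<close> B' by (subst sum.Sigma) auto
  ultimately show "fls_ge N (s - (\<Sum>(a, b)\<in>F. g a b))"
    by (simp add: sum_subtractf)
qed

lemma fls_null_family_Sigma_finite:
  assumes "finite A" "\<And>a. a \<in> A \<Longrightarrow> fls_null_family (g a) (B a)"
  shows "fls_null_family (\<lambda>(a, b). g a b) (Sigma A B)"
  unfolding fls_null_family_def
proof
  fix N
  have "{p \<in> Sigma A B. \<not> fls_ge N (case p of (a, b) \<Rightarrow> g a b)} =
      Sigma A (\<lambda>a. {b \<in> B a. \<not> fls_ge N (g a b)})" by auto
  then show "finite {p \<in> Sigma A B. \<not> fls_ge N (case p of (a, b) \<Rightarrow> g a b)}"
    using assms unfolding fls_null_family_def by simp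
qed

text \<open>In this direction the double family is known to be null, so it suffices to project its
  finitely many terms of low order: over any other index the whole inner sum has order at least
  N.\<close>

lemma fls_sums_SigmaD:
  assumes s: "fls_sums (\<lambda>(a, b). g a b) (Sigma A B) s"
    and g: "\<And>a. a \<in> A \<Longrightarrow> fls_sums (g a) (B a) (f a)"
  shows "fls_sums f A s"
  unfolding fls_sums_def
proof
  fix N
  define F where "F = {p \<in> Sigma A B. \<not> fls_ge N (case p of (a, b) \<Rightarrow> g a b)}"
  have finF: "finite F"
    using s by (auto simp: F_def fls_sums_iff_null_family fls_null_family_def)
  define B' where "B' a = Pair a -` F" for a
  have B': "finite (B' a)" "B' a \<subseteq> B a" "{b \<in> B a. \<not> fls_ge N (g a b)} \<subseteq> B' a" if "a \<in> A" for a
  proof -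
    show "finite (B' a)" unfolding B'_def by (rule finite_vimageI[OF finF]) (simp add: inj_on_def)
  qed (use that in \<open>auto simp: B'_def F_def\<close>)
  show "\<exists>F. finite F \<and> F \<subseteq> A \<and> (\<forall>F'. finite F' \<longrightarrow> F \<subseteq> F' \<longrightarrow> F' \<subseteq> A \<longrightarrow> fls_ge N (s - sum f F'))"
  proof (intro exI[of _ "fst ` F"] conjI allI impI)
    show "finite (fst ` F)" "fst ` F \<subseteq> A" using finF by (auto simp: F_def)
  next
    fix A' assume A': "finite A'" "fst ` F \<subseteq> A'" "A' \<subseteq> A"
    have FA: "F \<subseteq> Sigma A' B'" using A' by (force simp: B'_def)
    have sub: "Sigma A' B' \<subseteq> Sigma A B" "finite (Sigma A' B')" using A' B' by blast+
    have "fls_ge N (s - (\<Sum>(a, b)\<in>Sigma A' B'. g a b))"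
      using s FA sub unfolding fls_sums_iff_null_family F_def by blast
    moreover have "fls_ge N (\<Sum>a\<in>A'. f a - sum (g a) (B' a))"
      using g B' A' by (intro fls_ge_sum) (auto simp: fls_sums_iff_null_family)
    ultimately have "fls_ge N ((s - (\<Sum>(a, b)\<in>Sigma A' B'. g a b)) - (\<Sum>a\<in>A'. f a - sum (g a) (B' a)))"
      by (rule fls_ge_diff)
    moreover have "(\<Sum>(a, b)\<in>Sigma A' B'. g a b) = (\<Sum>a\<in>A'. sum (g a) (B' a))"
      using A' B' by (subst sum.Sigma) auto
    ultimately show "fls_ge N (s - sum f A')"
      by (simp add: sum_subtractf)
  qed
qed

section \<open>Two sources of summable families: convergence in the metric, and geometric
  series\<close>

lemma has_sum_imp_fls_sums:
  assumes "(f has_sum s) A"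
  shows "fls_sums f A s"
  unfolding fls_sums_def
proof
  fix N :: int
  have "(sum f \<longlongrightarrow> s) (finite_subsets_at_top A)" using assms by (simp add: has_sum_def)
  \<comment> \<open>Series at distance 2^(-v) differ in order v, so this radius forces v > N. For
    negative N the value \<open>nat N\<close> is 0, and radius 1 forces v > 0.\<close>
  then have "\<forall>\<^sub>F F in finite_subsets_at_top A. dist (sum f F) s < 1 / 2 ^ nat N"
    by (rule tendstoD) simp
  then obtain F where F: "finite F" "F \<subseteq> A"
    "\<And>F'. finite F' \<Longrightarrow> F \<subseteq> F' \<Longrightarrow> F' \<subseteq> A \<Longrightarrow> dist (sum f F') s < 1 / 2 ^ nat N"
    by (auto simp: eventually_finite_subsets_at_top)
  have "fls_ge N (s - t)" if "dist t s < 1 / 2 ^ nat N" for t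
  proof (cases "t = s")
    case False
    let ?j = "fls_subdegree (t - s)"
    have j: "\<not> ?j < N"
    proof
      assume "?j < N"
      show False
      proof (cases "?j < 0")
        case True
        have "1 / 2 ^ nat N \<le> (1::real)" by simp
        also have "\<dots> \<le> 2 ^ nat (- ?j)" by simp
        finally show False using that False True by (simp add: dist_fls_def)
      next
        case jnn: False
        then have "(2::real) ^ nat ?j \<le> 2 ^ nat N"
          using \<open>?j < N\<close> by (intro power_increasing) auto
        then have "1 / 2 ^ nat N \<le> 1 / (2::real) ^ nat ?j"
          by (simp add: field_simps)
        then show False using that False jnn by (simp add: dist_fls_def inverse_eq_divide)
      qed
    qed
    then show ?thesis
      unfolding fls_ge_iff_subdegree by (metis fls_subdegree_minus_sym not_le_imp_less)
  qed simp
  then show "\<exists>F. finite F \<and> F \<subseteq> A \<and> (\<forall>F'. finite F' \<longrightarrow> F \<subseteq> F' \<longrightarrow> F' \<subseteq> A \<longrightarrow> fls_ge N (s - sum f F'))"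
    by (intro exI[of _ F]) (use F in simp)
qed

lemma fls_sums_geometric:
  fixes a :: int
  assumes "a > 0"
  shows "fls_sums (\<lambda>e. fls_X_intpow (a * e) :: 'a::field fls) {E<..}
    (- fls_X_intpow (a * (E + 1)) / (fls_X_intpow a - 1))"
  unfolding fls_sums_def
proof
  fix N
  \<comment> \<open>Beyond M every e is nonnegative and at least N, so that a * e \<ge> e \<ge> N.
    The summand \<open>\<bar>E\<bar>\<close> ensures M \<ge> E, so that the interval from E to M has
    a natural number of elements.\<close>
  define M where "M = max N 0 + \<bar>E\<bar> + 1"
  have M: "N \<le> a * e" if "e > M" for e
  proof -
    have "0 \<le> e" "N \<le> e" using that by (auto simp: M_def)
    then show ?thesis using assms mult_right_mono[of 1 a e] by linarith
  qed
  let ?X = "\<lambda>i. fls_X_intpow i :: 'a fls"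
  have X1: "?X a - 1 \<noteq> 0"
  proof
    assume "?X a - 1 = 0"
    then have "fls_subdegree (?X a) = fls_subdegree (1 :: 'a fls)" by simp
    then show False using assms by simp
  qed
  \<comment> \<open>By telescoping, the error after M is
    \<open>- ?X (a * (M + 1)) / (?X a - 1)\<close>. Its order is a * (M + 1) because the denominator
    has order 0.\<close>
  have tele: "(?X a - 1) * (\<Sum>e\<in>{E<..E + int n}. ?X (a * e)) = ?X (a * (E + 1 + int n)) - ?X (a * (E + 1))" for n
  proof (induction n)
    case (Suc n)
    have "{E<..E + int (Suc n)} = insert (E + 1 + int n) {E<..E + int n}" by auto
    moreover have "a + a * (E + 1 + int n) = a * (E + 1 + int (Suc n))"
      by (simp add: algebra_simps)
    then have "?X a * ?X (a * (E + 1 + int n)) = ?X (a * (E + 1 + int (Suc n)))"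
      unfolding fls_X_intpow_times_fls_X_intpow by simp
    ultimately show ?case using Suc
      by (simp add: distrib_left left_diff_distrib)
  qed simp
  show "\<exists>F. finite F \<and> F \<subseteq> {E<..} \<and> (\<forall>F'. finite F' \<longrightarrow> F \<subseteq> F' \<longrightarrow> F' \<subseteq> {E<..} \<longrightarrow>
      fls_ge N (- ?X (a * (E + 1)) / (?X a - 1) - (\<Sum>e\<in>F'. ?X (a * e))))"
  proof (intro exI[of _ "{E<..M}"] conjI allI impI)
    fix F' assume F': "finite F'" "{E<..M} \<subseteq> F'" "F' \<subseteq> {E<..}"
    have "sum (\<lambda>e. ?X (a * e)) F' = sum (\<lambda>e. ?X (a * e)) {E<..M} + sum (\<lambda>e. ?X (a * e)) (F' - {E<..M})"
      using F' by (metis add.commute sum.subset_diff)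
    moreover have "fls_ge N (sum (\<lambda>e. ?X (a * e)) (F' - {E<..M}))"
      using F' by (intro fls_ge_sum) (auto intro!: M)
    moreover have "fls_ge N (- ?X (a * (E + 1)) / (?X a - 1) - (\<Sum>e\<in>{E<..M}. ?X (a * e)))"
    proof -
      have "M = E + int (nat (M - E))" by (auto simp: M_def)
      with tele[of "nat (M - E)"]
      have "(?X a - 1) * (\<Sum>e\<in>{E<..M}. ?X (a * e)) = ?X (a * (M + 1)) - ?X (a * (E + 1))"
        by (simp add: algebra_simps)
      then have "(\<Sum>e\<in>{E<..M}. ?X (a * e)) = (?X (a * (M + 1)) - ?X (a * (E + 1))) / (?X a - 1)"
        using X1 by (simp add: field_simps)
      then have "(- ?X (a * (E + 1)) / (?X a - 1) - (\<Sum>e\<in>{E<..M}. ?X (a * e))) =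
          - ?X (a * (M + 1)) / (?X a - 1)" (is "?t = _")
        by (simp add: diff_divide_distrib)
      then have eq: "?t * (?X a - 1) = - ?X (a * (M + 1))" using X1 by simp
      have sub: "fls_subdegree (?X a - 1) = 0"
        by (rule fls_subdegree_eqI) (use assms in auto)
      have "fls_subdegree (?t * (?X a - 1)) = a * (M + 1)" unfolding eq by simp
      then have "?t = 0 \<or> fls_subdegree ?t = a * (M + 1)"
        using X1 sub fls_subdegree_mult[of ?t "?X a - 1"] by linarith
      then show ?thesis unfolding fls_ge_iff_subdegree using M[of "M + 1"] by auto
    qed
    ultimately show "fls_ge N (- ?X (a * (E + 1)) / (?X a - 1) - (\<Sum>e\<in>F'. ?X (a * e)))"
      using fls_ge_diff by (metis (no_types, lifting) diff_diff_eq)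
  qed auto
qed

section \<open>Cutting a list into blocks\<close>

primrec psum :: "('a \<Rightarrow> 'a \<Rightarrow> int) \<Rightarrow> 'a list \<Rightarrow> int" where
  "psum \<phi> [] = 0"
| "psum \<phi> (x # xs) = (\<Sum>y\<leftarrow>xs. \<phi> x y) + psum \<phi> xs"

lemma psum_append: "psum \<phi> (xs @ ys) = psum \<phi> xs + psum \<phi> ys + (\<Sum>x\<leftarrow>xs. \<Sum>y\<leftarrow>ys. \<phi> x y)"
  by (induction xs) simp_all

lemma psum_map: "psum \<phi> (map f xs) = psum (\<lambda>x y. \<phi> (f x) (f y)) xs"
  by (induction xs) (simp_all add: o_def)

lemma psum_diff: "psum (\<lambda>x y. \<phi> x y - \<psi> x y) xs = psum \<phi> xs - psum \<psi> xs"
  by (induction xs) (simp_all add: sum_list_subtractf)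

lemma psum_upt:
  "psum \<phi> [1..<Suc r] = (\<Sum>k=1..r. \<Sum>l=1..r. if k > l then \<phi> l k else 0)"
proof (induction r)
  case (Suc r)
  let ?f = "\<lambda>k l. if k > l then \<phi> l k else 0"
  have 1: "(\<Sum>k=1..r. \<Sum>l=1..Suc r. ?f k l) = psum \<phi> [1..<Suc r]"
    unfolding Suc by (rule sum.cong[OF refl]) simp
  have "(\<Sum>l=1..Suc r. ?f (Suc r) l) = (\<Sum>l=1..r. \<phi> l (Suc r))"
    by (rule sum.mono_neutral_cong_right) auto
  also have "\<dots> = (\<Sum>x\<leftarrow>[1..<Suc r]. \<phi> x (Suc r))"
    by (simp only: interv_sum_list_conv_sum_set_nat set_upt atLeastLessThanSuc_atLeastAtMost)
  finally have 2: "(\<Sum>l=1..Suc r. ?f (Suc r) l) = (\<Sum>x\<leftarrow>[1..<Suc r]. \<phi> x (Suc r))" .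
  have "[1..<Suc (Suc r)] = [1..<Suc r] @ [Suc r]" by simp
  then have "psum \<phi> [1..<Suc (Suc r)] = psum \<phi> ([1..<Suc r] @ [Suc r])" by (rule arg_cong)
  also have "\<dots> = psum \<phi> [1..<Suc r] + (\<Sum>x\<leftarrow>[1..<Suc r]. \<phi> x (Suc r))"
    unfolding psum_append by simp
  also have "\<dots> = (\<Sum>k=1..Suc r. \<Sum>l=1..Suc r. ?f k l)"
    unfolding 1[symmetric] 2[symmetric] by simp
  finally show ?case .
qed simp

definition biadditive :: "('a::plus \<Rightarrow> 'a \<Rightarrow> int) \<Rightarrow> bool" where
  "biadditive \<phi> \<longleftrightarrow> (\<forall>x y z. \<phi> (x + y) z = \<phi> x z + \<phi> y z \<and> \<phi> z (x + y) = \<phi> z x + \<phi> z y)"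

lemma biadditive_sum_list:
  fixes \<phi> :: "'a::comm_monoid_add \<Rightarrow> 'a \<Rightarrow> int"
  assumes "biadditive \<phi>"
  shows "\<phi> (sum_list xs) y = (\<Sum>x\<leftarrow>xs. \<phi> x y)" "\<phi> y (sum_list xs) = (\<Sum>x\<leftarrow>xs. \<phi> y x)"
proof -
  have "\<phi> 0 y = 0" "\<phi> y 0 = 0"
    using assms unfolding biadditive_def by (metis add.right_neutral add_cancel_right_left)+
  then show "\<phi> (sum_list xs) y = (\<Sum>x\<leftarrow>xs. \<phi> x y)" "\<phi> y (sum_list xs) = (\<Sum>x\<leftarrow>xs. \<phi> y x)"
    using assms by (induction xs) (simp_all add: biadditive_def)
qed

text \<open>Pairs inside one block give the last sum. Pairs from two different blocks add up, by
  biadditivity, to the value of the form at the two block sums.\<close>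

lemma psum_concat:
  fixes \<phi> :: "'a::comm_monoid_add \<Rightarrow> 'a \<Rightarrow> int"
  assumes "biadditive \<phi>"
  shows "psum \<phi> (concat xss) = psum \<phi> (map sum_list xss) + (\<Sum>xs\<leftarrow>xss. psum \<phi> xs)"
proof (induction xss)
  case (Cons xs xss)
  have "(\<Sum>x\<leftarrow>xs. \<Sum>y\<leftarrow>concat xss. \<phi> x y) = (\<Sum>ys\<leftarrow>xss. \<phi> (sum_list xs) (sum_list ys))"
  proof (induction xss)
    case (Cons ys yss)
    have "(\<Sum>x\<leftarrow>xs. \<Sum>y\<leftarrow>ys. \<phi> x y) = \<phi> (sum_list xs) (sum_list ys)"
      by (simp only: biadditive_sum_list(2)[OF assms, symmetric] biadditive_sum_list(1)[OF assms, symmetric])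
    with Cons show ?case by (simp add: sum_list_addf)
  qed simp
  with Cons show ?case by (simp add: psum_append o_def)
qed simp

section \<open>Compositions of a list, that is, choices of a set of gaps to cut\<close>

primrec merge_first :: "'a \<Rightarrow> 'a list list \<Rightarrow> 'a list list" where
  "merge_first z [] = [[z]]"
| "merge_first z (y # yss) = (z # y) # yss"

definition comps :: "'a list \<Rightarrow> 'a list list set" where
  "comps zs = {xss. concat xss = zs \<and> [] \<notin> set xss}"

lemma comps_Nil [simp]: "comps [] = {[]}"
  by (auto simp: comps_def) (metis last_in_set)

lemma comps_single [simp]: "comps [z] = {[[z]]}"
proof -
  have "xss = [[z]]" if "concat xss = [z]" "[] \<notin> set xss" for xss
  proof (cases xss)
    case (Cons xs yss)
    with that have "xs = [z]" "concat yss = []" by (cases xs; auto)+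
    with that Cons show ?thesis by (cases yss) auto
  qed (use that in auto)
  then show ?thesis by (auto simp: comps_def)
qed

text \<open>The first gap is either cut, making \<open>[z]\<close> a block of its own, or joined,
  putting z in front of the next block. A composition of a nonempty list has a first block, so the
  \<open>[]\<close> clause of \<open>merge_first\<close> is never met here.\<close>

lemma comps_Cons:
  "comps (z # z' # w) = (#) [z] ` comps (z' # w) \<union> merge_first z ` comps (z' # w)"
proof (intro equalityI subsetI)
  fix xss assume "xss \<in> comps (z # z' # w)"
  then obtain x yss where x: "xss = (z # x) # yss" "x @ concat yss = z' # w" "[] \<notin> set yss"
    by (cases xss; cases "hd xss") (auto simp: comps_def)
  show "xss \<in> (#) [z] ` comps (z' # w) \<union> merge_first z ` comps (z' # w)"
  proof (cases "x = []")
    case True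
    with x show ?thesis by (auto simp: comps_def)
  next
    case False
    with x have "x # yss \<in> comps (z' # w)" "xss = merge_first z (x # yss)" by (auto simp: comps_def)
    then show ?thesis by blast
  qed
next
  fix xss assume "xss \<in> (#) [z] ` comps (z' # w) \<union> merge_first z ` comps (z' # w)"
  then show "xss \<in> comps (z # z' # w)"
  proof
    assume "xss \<in> merge_first z ` comps (z' # w)"
    then obtain yss where "yss \<in> comps (z' # w)" "xss = merge_first z yss" by blast
    then show ?thesis by (cases yss) (auto simp: comps_def)
  qed (auto simp: comps_def)
qed

lemma comps_Cons_disjoint: "(#) [z] ` comps (z' # w) \<inter> merge_first z ` comps (z' # w) = {}"
proof -
  have "[z] # yss \<noteq> merge_first z yss'" if "yss' \<in> comps (z' # w)" for yss yss'
    using that by (cases yss') (auto simp: comps_def)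
  then show ?thesis by fastforce
qed

lemma inj_merge_first: "inj_on (merge_first z) (comps (z' # w))"
proof (rule inj_onI)
  fix xss yss assume "xss \<in> comps (z' # w)" "yss \<in> comps (z' # w)" "merge_first z xss = merge_first z yss"
  then show "xss = yss" by (cases xss; cases yss) (auto simp: comps_def)
qed

lemma finite_comps: "finite (comps zs)"
proof (induction zs rule: induct_list012)
  case (3 z z' w)
  then show ?case by (simp add: comps_Cons)
qed simp_all

lemma sum_comps_Cons:
  fixes f :: "_ \<Rightarrow> 'b::comm_monoid_add"
  shows "sum f (comps (z # z' # w)) =
    (\<Sum>yss\<in>comps (z' # w). f ([z] # yss)) + (\<Sum>yss\<in>comps (z' # w). f (merge_first z yss))"
proof -
  have "sum f (comps (z # z' # w)) = sum f ((#) [z] ` comps (z' # w)) + sum f (merge_first z ` comps (z' # w))"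
    unfolding comps_Cons by (intro sum.union_disjoint finite_imageI finite_comps comps_Cons_disjoint)
  also have "sum f ((#) [z] ` comps (z' # w)) = (\<Sum>yss\<in>comps (z' # w). f ([z] # yss))"
    by (subst sum.reindex) auto
  also have "sum f (merge_first z ` comps (z' # w)) = (\<Sum>yss\<in>comps (z' # w). f (merge_first z yss))"
    by (subst sum.reindex[OF inj_merge_first]) auto
  finally show ?thesis .
qed

section \<open>Slopes and the alternating count of block decompositions\<close>

text \<open>The properties of data on which the argument rests. Working in a commutative monoid
  turns regrouping and initial segments into \<open>sum_list\<close>; the zero element is outside D
  but serves as an empty initial segment. The value \<open>sg g h\<close> is what an entry g
  contributes to \<sigma> together with a later entry h.\<close>

locale slope_data =
  fixes D :: "'g::comm_monoid_add set" and n :: "'g \<Rightarrow> nat" and al :: "'g \<Rightarrow> real"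
    and sg :: "'g \<Rightarrow> 'g \<Rightarrow> int"
  assumes D_add: "g \<in> D \<Longrightarrow> h \<in> D \<Longrightarrow> g + h \<in> D"
    and n_add: "n (g + h) = n g + n h"
    and n_pos: "g \<in> D \<Longrightarrow> 0 < n g"
    and al_add: "al (g + h) = al g + al h"
    and sg_biadditive: "biadditive sg"
    and finite_summands: "R \<in> D \<Longrightarrow> finite {g \<in> D. \<exists>h. g + h = R}"
begin

lemma n_0 [simp]: "n 0 = 0"
  using n_add[of 0 0] by simp

lemma al_0 [simp]: "al 0 = 0"
  using al_add[of 0 0] by simp

definition E :: "('g \<times> int) set" where
  "E = D \<times> UNIV"

text \<open>The parabolic degree in the language of parabolic bundles; \<open>slope\<close> is the
  parabolic slope.\<close>

definition deg :: "'g \<times> int \<Rightarrow> real" where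
  "deg x = real_of_int (snd x) + al (fst x)"

definition slope :: "'g \<times> int \<Rightarrow> real" where
  "slope x = deg x / real (n (fst x))"

text \<open>The signed vertical distance from the line of slope \<open>\<mu>\<close> through the
  origin. Unlike the slope it is additive, hence suited to partial sums, and its sign still compares
  the slope with \<open>\<mu>\<close>.\<close>

definition height :: "real \<Rightarrow> 'g \<times> int \<Rightarrow> real" where
  "height \<mu> x = deg x - \<mu> * real (n (fst x))"

text \<open>The exponent \<open>N\<close> of a list is \<open>psum euler\<close>; the part \<open>sg\<close> accounts for \<open>\<sigma>\<close>.\<close>

definition euler :: "'g \<times> int \<Rightarrow> 'g \<times> int \<Rightarrow> int" where
  "euler x y = snd x * int (n (fst y)) - snd y * int (n (fst x)) - sg (fst x) (fst y)"

abbreviation decreasing :: "('g \<times> int) list \<Rightarrow> bool" where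
  "decreasing \<equiv> sorted_wrt (\<lambda>x y. slope x > slope y)"

text \<open>The Harder-Narasimhan types of total y, which index the recursion in the
  hypothesis.\<close>

definition hn :: "'g \<times> int \<Rightarrow> ('g \<times> int) list set" where
  "hn y = {xs. xs \<noteq> [] \<and> set xs \<subseteq> E \<and> sum_list xs = y \<and> decreasing xs}"

definition above :: "'g \<times> int \<Rightarrow> ('g \<times> int) list set" where
  "above y = {ys. ys \<noteq> [] \<and> set ys \<subseteq> E \<and> sum_list ys = y \<and>
     (\<forall>k. 0 < k \<longrightarrow> k < length ys \<longrightarrow> 0 < height (slope y) (sum_list (take k ys)))}"

definition decomps :: "'g \<Rightarrow> 'g list set" where
  "decomps R = {Rs. Rs \<noteq> [] \<and> set Rs \<subseteq> D \<and> sum_list Rs = R}"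

lemma E_add: "x \<in> E \<Longrightarrow> y \<in> E \<Longrightarrow> x + y \<in> E"
  by (cases x; cases y) (auto simp: E_def D_add)

lemma E_sum_list: "set xs \<subseteq> E \<Longrightarrow> xs \<noteq> [] \<Longrightarrow> sum_list xs \<in> E"
proof (induction xs)
  case (Cons x xs)
  then show ?case by (cases "xs = []") (auto intro: E_add)
qed simp

lemma height_0 [simp]: "height \<mu> 0 = 0"
  by (simp add: height_def deg_def)

lemma height_add: "height \<mu> (x + y) = height \<mu> x + height \<mu> y"
  by (cases x; cases y) (simp add: height_def deg_def n_add al_add ring_distribs)

lemma height_eq: "x \<in> E \<Longrightarrow> height \<mu> x = real (n (fst x)) * (slope x - \<mu>)"
  using n_pos[of "fst x"] by (auto simp: height_def slope_def E_def field_simps)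

lemma height_pos_iff: "x \<in> E \<Longrightarrow> 0 < height \<mu> x \<longleftrightarrow> \<mu> < slope x"
  using n_pos[of "fst x"] by (auto simp: height_eq zero_less_mult_iff E_def)

lemma height_neg_iff: "x \<in> E \<Longrightarrow> height \<mu> x < 0 \<longleftrightarrow> slope x < \<mu>"
  using n_pos[of "fst x"] by (auto simp: height_eq mult_less_0_iff E_def)

lemma euler_biadditive: "biadditive euler"
  using sg_biadditive by (simp add: biadditive_def euler_def n_add ring_distribs)

text \<open>The offset p is the sum of the entries already passed. It permits a recursion along the
  list while \<open>\<mu>\<close> stays the slope of the whole.\<close>

definition block_ok :: "real \<Rightarrow> 'g \<times> int \<Rightarrow> ('g \<times> int) list list \<Rightarrow> bool" where
  "block_ok \<mu> p xss \<longleftrightarrow> (\<forall>xs\<in>set xss. decreasing xs) \<and>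
     (\<forall>k. 0 < k \<longrightarrow> k < length xss \<longrightarrow> 0 < height \<mu> (p + sum_list (take k (map sum_list xss))))"

text \<open>The sign is the negative of the (-1)^(r-1) of the expansion, so a singleton counts -1;
  this is the minus sign in the conclusion of \<open>inversion\<close>.\<close>

definition signed_count :: "real \<Rightarrow> 'g \<times> int \<Rightarrow> ('g \<times> int) list \<Rightarrow> int" where
  "signed_count \<mu> p zs = (\<Sum>xss\<in>comps zs. if block_ok \<mu> p xss then (- 1) ^ length xss else 0)"

lemma block_ok_Cons:
  assumes "yss \<noteq> []"
  shows "block_ok \<mu> p (xs # yss) \<longleftrightarrow>
    decreasing xs \<and> 0 < height \<mu> (p + sum_list xs) \<and> block_ok \<mu> (p + sum_list xs) yss"
proof -
  have "(\<forall>k. 0 < k \<longrightarrow> k < Suc (length yss) \<longrightarrow> 0 < height \<mu> (p + sum_list (take k (map sum_list (xs # yss))))) \<longleftrightarrow>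
     (\<forall>k < length yss. 0 < height \<mu> (p + sum_list xs + sum_list (take k (map sum_list yss))))"
    (is "?L \<longleftrightarrow> ?R")
  proof
    assume ?L
    show ?R
    proof (intro allI impI)
      fix k assume "k < length yss"
      with \<open>?L\<close>[rule_format, of "Suc k"]
      show "0 < height \<mu> (p + sum_list xs + sum_list (take k (map sum_list yss)))"
        by (simp add: add.assoc)
    qed
  next
    assume ?R
    show ?L
    proof (intro allI impI)
      fix k assume "0 < k" "k < Suc (length yss)"
      then show "0 < height \<mu> (p + sum_list (take k (map sum_list (xs # yss))))"
        using \<open>?R\<close>[rule_format, of "k - 1"] by (cases k) (simp_all add: add.assoc)
    qed
  qed
  moreover have "?R \<longleftrightarrow> 0 < height \<mu> (p + sum_list xs) \<and>
     (\<forall>k. 0 < k \<longrightarrow> k < length yss \<longrightarrow> 0 < height \<mu> (p + sum_list xs + sum_list (take k (map sum_list yss))))"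
    (is "_ \<longleftrightarrow> ?R'")
  proof
    assume ?R
    from this[rule_format, of 0] this assms show ?R' by simp
  next
    assume ?R'
    then show ?R by (metis add.right_neutral bot_nat_0.not_eq_extremum sum_list.Nil take0)
  qed
  ultimately show ?thesis by (auto simp: block_ok_def)
qed

lemma decreasing_Cons2: "decreasing (x # y # zs) \<longleftrightarrow> slope x > slope y \<and> decreasing (y # zs)"
  by (rule sorted_wrt2) (auto simp: transp_def)

text \<open>Prefixing z to the first block adds z to every nonempty initial sum of blocks, which is
  a shift of the offset. Since slopes are compared transitively, the only new condition is the one
  between z and its neighbour.\<close>

lemma block_ok_merge_first:
  assumes "yss \<in> comps (z' # w)"
  shows "block_ok \<mu> p (merge_first z yss) \<longleftrightarrow> slope z > slope z' \<and> block_ok \<mu> (p + z) yss"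
proof (cases yss)
  case Nil
  with assms show ?thesis by (simp add: comps_def)
next
  case (Cons y yss')
  with assms obtain v where y: "y = z' # v"
    by (cases y) (auto simp: comps_def)
  have eq: "p + sum_list (take k (map sum_list ((z # z' # v) # yss'))) =
      p + z + sum_list (take k (map sum_list ((z' # v) # yss')))" if "0 < k" for k
    using that by (cases k) (simp_all add: add.assoc)
  show ?thesis
    unfolding block_ok_def Cons merge_first.simps
    unfolding y using decreasing_Cons2[of z z' v] by (auto simp: eq simp del: list.map sorted_wrt.simps)
qed

text \<open>At the gap between \<open>z\<close> and \<open>z'\<close> one may join if the slope decreases and may cut, at the cost of a
  sign, if the partial sum lies above slope \<open>\<mu>\<close>; the two choices are independent of the other gaps.\<close>

lemma signed_count_Cons:
  "signed_count \<mu> p (z # z' # w) =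
     ((if slope z > slope z' then 1 else 0) - (if 0 < height \<mu> (p + z) then 1 else 0)) *
     signed_count \<mu> (p + z) (z' # w)"
proof -
  let ?f = "\<lambda>p xss. if block_ok \<mu> p xss then (- 1 :: int) ^ length xss else 0"
  have ne: "yss \<noteq> []" if "yss \<in> comps (z' # w)" for yss using that by (auto simp: comps_def)
  have "(\<Sum>yss\<in>comps (z' # w). ?f p ([z] # yss)) =
      (\<Sum>yss\<in>comps (z' # w). - (if 0 < height \<mu> (p + z) then 1 else 0) * ?f (p + z) yss)"
    by (intro sum.cong) (auto simp: block_ok_Cons ne)
  moreover have "length (merge_first z yss) = length yss" if "yss \<in> comps (z' # w)" for yss
    using ne[OF that] by (cases yss) auto
  then have "(\<Sum>yss\<in>comps (z' # w). ?f p (merge_first z yss)) =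
      (\<Sum>yss\<in>comps (z' # w). (if slope z > slope z' then 1 else 0) * ?f (p + z) yss)"
    by (intro sum.cong) (auto simp: block_ok_merge_first)
  ultimately show ?thesis
    unfolding signed_count_def sum_comps_Cons
    by (simp add: sum_distrib_left[symmetric] left_diff_distrib sum_negf)
qed

lemma signed_count_single: "signed_count \<mu> p [z] = - 1"
  by (simp add: signed_count_def block_ok_def)

text \<open>A nonzero count has a nonzero factor at every gap. Above the line a cut is allowed, so
  the factor survives only if joining is forbidden, that is, if the slope does not decrease. A path
  that starts by rising relative to the line keeps rising.\<close>

lemma height_pos_if_signed_count_nz:
  assumes "signed_count \<mu> p (z # w) \<noteq> 0" "set (z # w) \<subseteq> E" "0 \<le> height \<mu> p" "0 < height \<mu> z"
  shows "0 < height \<mu> (p + sum_list (z # w))"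
  using assms
proof (induction w arbitrary: p z)
  case (Cons z' w)
  have pos: "0 < height \<mu> (p + z)" using Cons.prems by (simp add: height_add)
  then have "slope z \<le> slope z'" and nz: "signed_count \<mu> (p + z) (z' # w) \<noteq> 0"
    using Cons.prems(1) by (auto simp: signed_count_Cons split: if_splits)
  then have "0 < height \<mu> z'"
    using Cons.prems height_pos_iff[of z \<mu>] height_pos_iff[of z' \<mu>] by auto
  then show ?case using Cons.IH[of "p + z" z'] nz Cons.prems pos by (simp add: add.assoc)
qed (simp add: height_add)

text \<open>The mirror image: on or below the line no cut is allowed, so joining must be, the slope
  strictly decreases, and a path that falls keeps falling.\<close>

lemma height_neg_if_signed_count_nz:
  assumes "signed_count \<mu> p (z # w) \<noteq> 0" "set (z # w) \<subseteq> E" "height \<mu> p \<le> 0" "height \<mu> z < 0"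
  shows "height \<mu> (p + sum_list (z # w)) < 0"
  using assms
proof (induction w arbitrary: p z)
  case (Cons z' w)
  have neg: "height \<mu> (p + z) < 0" using Cons.prems by (simp add: height_add)
  then have "slope z > slope z'" and nz: "signed_count \<mu> (p + z) (z' # w) \<noteq> 0"
    using Cons.prems(1) by (auto simp: signed_count_Cons split: if_splits)
  then have "height \<mu> z' < 0"
    using Cons.prems height_neg_iff[of z \<mu>] height_neg_iff[of z' \<mu>] by auto
  then show ?case using Cons.IH[of "p + z" z'] nz Cons.prems neg by (simp add: add.assoc)
qed (simp add: height_add)

lemma signed_count_eq_0:
  assumes "length zs \<noteq> 1" "zs \<noteq> []" "set zs \<subseteq> E" "height \<mu> (sum_list zs) = 0"
  shows "signed_count \<mu> 0 zs = 0"
proof (rule ccontr)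
  assume nz: "signed_count \<mu> 0 zs \<noteq> 0"
  from assms obtain z z' w where zs: "zs = z # z' # w"
    by (metis One_nat_def length_Cons list.exhaust list.size(3))
  show False
  proof (cases "0 < height \<mu> z")
    case True
    then show False using height_pos_if_signed_count_nz[of \<mu> 0 z "z' # w"] nz assms zs by simp
  next
    case False
    \<comment> \<open>The first step may end exactly on the line and so need not fall. Joining at
      the first gap makes z' fall strictly, and the descent starts there with offset z.\<close>
    then have "slope z' < slope z" and nz': "signed_count \<mu> z (z' # w) \<noteq> 0"
      using nz by (auto simp: signed_count_Cons zs split: if_splits)
    moreover have "slope z \<le> \<mu>" using False assms height_pos_iff[of z \<mu>] by (auto simp: zs)
    ultimately have "height \<mu> z' < 0" using assms height_neg_iff[of z' \<mu>] by (auto simp: zs)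
    then show False
      using height_neg_if_signed_count_nz[of \<mu> z z' w] nz' False assms zs by simp
  qed
qed

end

section \<open>Inverting the recursion\<close>

lemma psum_ge_if_sorted_wrt:
  assumes "sorted_wrt P xs" "0 \<le> B"
    "\<And>x y. x \<in> set xs \<Longrightarrow> y \<in> set xs \<Longrightarrow> P x y \<Longrightarrow> - B \<le> \<phi> x y"
  shows "- (B * int (length xs) * int (length xs)) \<le> psum \<phi> xs"
  using assms
proof (induction xs)
  case (Cons x xs)
  let ?l = "int (length xs)"
  have "- (B * ?l) = (\<Sum>y\<leftarrow>xs. - B)" by (simp add: sum_list_triv)
  also have "\<dots> \<le> (\<Sum>y\<leftarrow>xs. \<phi> x y)"
    using Cons.prems by (intro sum_list_mono) auto
  finally have "- (B * ?l) \<le> (\<Sum>y\<leftarrow>xs. \<phi> x y)" .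
  moreover have "- (B * ?l * ?l) \<le> psum \<phi> xs" using Cons by auto
  moreover have "0 \<le> B * ?l" using \<open>0 \<le> B\<close> by simp
  moreover have "B * int (length (x # xs)) * int (length (x # xs)) = B * ?l * ?l + 2 * (B * ?l) + B"
    by (simp add: ring_distribs)
  ultimately show ?case using \<open>0 \<le> B\<close> unfolding psum.simps by linarith
qed simp

text \<open>The bound is taken nonpositive so that a product of at most k factors has order at least
  k * c, whatever its exact length.\<close>

lemma fls_ge_uniform:
  assumes "finite A" "\<And>a. a \<in> A \<Longrightarrow> \<exists>c. \<forall>y\<in>B a. fls_ge c (f y)"
  shows "\<exists>c\<le>0. \<forall>a\<in>A. \<forall>y\<in>B a. fls_ge c (f y)"
  using assms
proof (induction A)
  case (insert a A)
  then obtain c c' where "c \<le> 0" "\<forall>a\<in>A. \<forall>y\<in>B a. fls_ge c (f y)" "\<forall>y\<in>B a. fls_ge c' (f y)"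
    by (metis insertCI)
  then show ?case
    by (intro exI[of _ "min c c'"]) (auto intro: fls_ge_mono[OF _ min.cobounded1] fls_ge_mono[OF _ min.cobounded2])
qed auto

context slope_data
begin

section \<open>Finiteness and lower bounds on exponents that do not involve the degree\<close>

definition summands :: "'g \<Rightarrow> 'g set" where
  "summands R = {g \<in> D. \<exists>h. g + h = R}"

lemma length_le_n: "set xs \<subseteq> E \<Longrightarrow> length xs \<le> n (fst (sum_list xs))"
proof (induction xs)
  case (Cons x xs)
  then show ?case using n_pos[of "fst x"] by (auto simp: n_add E_def)
qed simp

lemma fst_in_summands:
  assumes "x \<in> set xs" "set xs \<subseteq> E"
  shows "fst x \<in> summands (fst (sum_list xs))"
proof -
  from assms obtain as bs where "xs = as @ x # bs" by (meson split_list)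
  then have "fst (sum_list xs) = fst x + fst (sum_list (as @ bs))"
    by (simp add: ac_simps)
  then show ?thesis using assms by (auto simp: summands_def E_def)
qed

lemma n_summand_less:
  assumes "x \<in> set xs" "set xs \<subseteq> E" "1 < length xs"
  shows "n (fst x) < n (fst (sum_list xs))"
proof -
  from assms obtain as bs where xs: "xs = as @ x # bs" by (meson split_list)
  then have "fst (sum_list xs) = fst x + fst (sum_list (as @ bs))"
    by (simp add: ac_simps)
  moreover have "1 \<le> n (fst (sum_list (as @ bs)))"
  proof -
    have "length xs = Suc (length (as @ bs))" using xs by simp
    then have "1 \<le> length (as @ bs)" using assms(3) by linarith
    moreover have "set (as @ bs) \<subseteq> E" using assms xs by auto
    ultimately show ?thesis using length_le_n le_trans by blast
  qed
  ultimately show ?thesis by (simp only: n_add)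
qed

lemma euler_lower_bound:
  assumes "R \<in> D"
  shows "\<exists>B\<ge>0. \<forall>x y. fst x \<in> summands R \<longrightarrow> fst y \<in> summands R \<longrightarrow> slope x > slope y \<longrightarrow> - B \<le> euler x y"
proof -
  \<comment> \<open>The condition slope x > slope y says d_y n_x - d_x n_y < al_x n_y - al_y n_x. No
    degree occurs on the right, so only finitely many pairs of summands matter.\<close>
  define b where "b = (\<lambda>(g, h). \<bar>\<lceil>al g * real (n h) - al h * real (n g)\<rceil>\<bar> + \<bar>sg g h\<bar>)"
  let ?A = "insert 0 (b ` (summands R \<times> summands R))"
  have fin: "finite ?A" using finite_summands[OF assms] by (simp add: summands_def)
  show ?thesis
  proof (intro exI[of _ "Max ?A"] conjI allI impI)
    show "0 \<le> Max ?A" using fin by simp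
  next
    fix x y assume xy: "fst x \<in> summands R" "fst y \<in> summands R" "slope x > slope y"
    have "0 < n (fst x)" "0 < n (fst y)" using xy n_pos by (auto simp: summands_def)
    with xy have "deg y * real (n (fst x)) < deg x * real (n (fst y))"
      by (simp add: slope_def field_simps)
    then have "real_of_int (snd y * int (n (fst x)) - snd x * int (n (fst y))) <
        al (fst x) * real (n (fst y)) - al (fst y) * real (n (fst x))"
      by (simp add: deg_def ring_distribs)
    then have "- b (fst x, fst y) \<le> euler x y"
      unfolding b_def euler_def by (simp only: prod.case) linarith
    moreover have "b (fst x, fst y) \<le> Max ?A" using fin xy by (intro Max_ge) auto
    ultimately show "- Max ?A \<le> euler x y" by linarith
  qed
qed

lemma psum_hn_lower_bound:
  assumes "R \<in> D"
  shows "\<exists>b. \<forall>d. \<forall>xs\<in>hn (R, d). b \<le> psum euler xs"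
proof -
  obtain B where B: "0 \<le> B" "\<And>x y. fst x \<in> summands R \<Longrightarrow> fst y \<in> summands R \<Longrightarrow>
      slope x > slope y \<Longrightarrow> - B \<le> euler x y"
    using euler_lower_bound[OF assms] by blast
  have "- (B * int (n R) * int (n R)) \<le> psum euler xs" if "xs \<in> hn (R, d)" for d xs
  proof -
    from that have xs: "set xs \<subseteq> E" "sum_list xs = (R, d)" "decreasing xs" by (auto simp: hn_def)
    have "fst x \<in> summands R" if "x \<in> set xs" for x
      using fst_in_summands[OF that xs(1)] xs(2) by simp
    then have "- (B * int (length xs) * int (length xs)) \<le> psum euler xs"
      using B(1) by (intro psum_ge_if_sorted_wrt[OF xs(3)] B(2))
    moreover have "B * int (length xs) * int (length xs) \<le> B * int (n R) * int (n R)"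
      using length_le_n[OF xs(1)] xs(2) B(1) by (intro mult_mono) auto
    ultimately show ?thesis by linarith
  qed
  then show ?thesis by blast
qed

lemma finite_decomps:
  assumes "R \<in> D"
  shows "finite (decomps R)"
proof (rule finite_subset)
  show "finite {Rs. set Rs \<subseteq> summands R \<and> length Rs \<le> n R}"
    using finite_summands[OF assms] by (intro finite_lists_length_le) (simp add: summands_def)
  show "decomps R \<subseteq> {Rs. set Rs \<subseteq> summands R \<and> length Rs \<le> n R}"
  proof
    fix Rs assume "Rs \<in> decomps R"
    then have Rs: "set Rs \<subseteq> D" "sum_list Rs = R" by (auto simp: decomps_def)
    \<comment> \<open>Degree 0 is attached only to make the lemmas on lists over \<open>E\<close>
      applicable.\<close>
    let ?xs = "map (\<lambda>g. (g, 0)) Rs"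
    have E: "set ?xs \<subseteq> E" using Rs by (auto simp: E_def)
    have sum: "fst (sum_list ?xs) = R" unfolding Rs(2)[symmetric] by (induction Rs) simp_all
    have "length Rs \<le> n R" using length_le_n[OF E] unfolding sum by simp
    moreover have "g \<in> summands R" if "g \<in> set Rs" for g
      using fst_in_summands[OF _ E, of "(g, 0)"] that unfolding sum by auto
    ultimately show "Rs \<in> {Rs. set Rs \<subseteq> summands R \<and> length Rs \<le> n R}" by auto
  qed
qed

definition weight :: "('g \<times> int \<Rightarrow> 'c::field fls) \<Rightarrow> ('g \<times> int) list \<Rightarrow> 'c fls" where
  "weight f xs = fls_X_intpow (psum euler xs) * prod_list (map f xs)"

lemma weight_ge:
  assumes "b \<le> psum euler xs" "\<And>x. x \<in> set xs \<Longrightarrow> fls_ge c (f x)" "c \<le> 0" "length xs \<le> k"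
  shows "fls_ge (b + int k * c) (weight f xs)"
proof -
  have "fls_ge (int (length (map f xs)) * c) (prod_list (map f xs))"
    using assms by (intro fls_ge_prod_list) auto
  moreover have "int k * c \<le> int (length (map f xs)) * c"
    using assms by (intro mult_right_mono_neg) auto
  ultimately have "fls_ge (int k * c) (prod_list (map f xs))" by (rule fls_ge_mono)
  then show ?thesis unfolding weight_def using assms by (intro fls_ge_mult) auto
qed

text \<open>Substituting an expansion for each entry of an outer list leaves a term that depends on
  the concatenation alone, not on where it was cut. This is why the cuts can be counted
  separately.\<close>

lemma weight_concat:
  "weight f (concat xss) = fls_X_intpow (psum euler (map sum_list xss)) * prod_list (map (weight f) xss)"
proof -
  have "prod_list (map (weight f) xss) =
      fls_X_intpow (\<Sum>xs\<leftarrow>xss. psum euler xs) * prod_list (map f (concat xss))"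
  proof (induction xss)
    case (Cons xs xss)
    have "prod_list (map (weight f) (xs # xss)) =
        (fls_X_intpow (psum euler xs) * fls_X_intpow (\<Sum>xs\<leftarrow>xss. psum euler xs)) *
        prod_list (map f (concat (xs # xss)))"
      by (simp add: Cons weight_def)
    then show ?case by (simp only: fls_X_intpow_times_fls_X_intpow list.map sum_list.Cons)
  qed simp
  then show ?thesis
    unfolding weight_def psum_concat[OF euler_biadditive]
    by (simp only: fls_X_intpow_times_fls_X_intpow[symmetric] mult.assoc)
qed

lemma single_in_hn: "x \<in> E \<Longrightarrow> [x] \<in> hn x"
  by (simp add: hn_def)

lemma hn_length_1: "xs \<in> hn x \<Longrightarrow> length xs = 1 \<Longrightarrow> xs = [x]"
  by (cases xs) (auto simp: hn_def)

text \<open>The double index set sorted by the list of block sums; \<open>comp_families\<close>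
  sorts the same set by the concatenated list.\<close>

definition hn_families :: "('g \<times> int) \<Rightarrow> (('g \<times> int) list \<times> ('g \<times> int) list list) set" where
  "hn_families y = (SIGMA ys : above y. {xss. list_all2 (\<lambda>x xs. xs \<in> hn x) ys xss})"

definition comp_families :: "('g \<times> int) \<Rightarrow> (('g \<times> int) list \<times> ('g \<times> int) list list) set" where
  "comp_families y = (SIGMA zs : {zs. zs \<noteq> [] \<and> set zs \<subseteq> E \<and> sum_list zs = y}.
     {xss \<in> comps zs. block_ok (slope y) 0 xss})"

lemma list_all2_hn_iff:
  "list_all2 (\<lambda>x xs. xs \<in> hn x) ys xss \<longleftrightarrow>
     ys = map sum_list xss \<and> (\<forall>xs\<in>set xss. xs \<noteq> [] \<and> set xs \<subseteq> E \<and> decreasing xs)"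
  by (induction xss arbitrary: ys) (auto simp: hn_def list_all2_Cons2)

lemma hn_families_iff:
  "(ys, xss) \<in> hn_families y \<longleftrightarrow> ys = map sum_list xss \<and> (concat xss, xss) \<in> comp_families y"
proof -
  have sum_concat: "sum_list (map sum_list xss) = sum_list (concat xss)"
    by (induction xss) simp_all
  have above_iff: "map sum_list xss \<in> above y \<longleftrightarrow> xss \<noteq> [] \<and> sum_list (concat xss) = y \<and>
      (\<forall>k. 0 < k \<longrightarrow> k < length xss \<longrightarrow> 0 < height (slope y) (sum_list (take k (map sum_list xss))))"
    if "\<forall>xs\<in>set xss. xs \<noteq> [] \<and> set xs \<subseteq> E"
  proof -
    have "set (map sum_list xss) \<subseteq> E" using that by (auto simp: E_sum_list)
    then show ?thesis by (simp add: above_def sum_concat)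
  qed
  have comp_iff: "(concat xss, xss) \<in> comp_families y \<longleftrightarrow>
      (\<forall>xs\<in>set xss. xs \<noteq> [] \<and> set xs \<subseteq> E \<and> decreasing xs) \<and> map sum_list xss \<in> above y"
  proof (cases "\<forall>xs\<in>set xss. xs \<noteq> [] \<and> set xs \<subseteq> E")
    case True
    then have "concat xss \<noteq> [] \<longleftrightarrow> xss \<noteq> []" "set (concat xss) \<subseteq> E" "concat xss \<in> {zs. xss \<in> comps zs}"
      by (auto simp: comps_def)
    with True show ?thesis
      unfolding above_iff[OF True] by (simp add: comp_families_def block_ok_def) blast
  next
    case False
    then show ?thesis by (auto simp: comp_families_def comps_def)
  qed
  show ?thesis unfolding comp_iff unfolding hn_families_def mem_Sigma_iff mem_Collect_eq list_all2_hn_iff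
    by blast
qed

lemma bij_betw_families: "bij_betw (\<lambda>(ys, xss). (concat xss, xss)) (hn_families y) (comp_families y)"
proof (rule bij_betwI[where g = "\<lambda>(zs, xss). (map sum_list xss, xss)"])
  show "(\<lambda>(ys, xss). (concat xss, xss)) \<in> hn_families y \<rightarrow> comp_families y"
    by (auto simp: hn_families_iff)
  have zs: "zs = concat xss" if "(zs, xss) \<in> comp_families y" for zs xss
    using that by (simp add: comp_families_def comps_def)
  show "(\<lambda>(zs, xss). (map sum_list xss, xss)) \<in> comp_families y \<rightarrow> hn_families y"
    using zs by (auto simp: hn_families_iff)
  show "(case case p of (zs, xss) \<Rightarrow> (map sum_list xss, xss) of (ys, xss) \<Rightarrow> (concat xss, xss)) = p"
    if "p \<in> comp_families y" for p
    using zs that by (cases p) simp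
qed (auto simp: hn_families_iff)

section \<open>Inversion for a family that satisfies the recursion\<close>

context
  fixes Qd :: "'g \<times> int \<Rightarrow> 'c::field fls" and Q :: "'g \<Rightarrow> 'c fls"
  assumes recursion: "\<And>x. x \<in> E \<Longrightarrow> fls_sums (weight Qd) (hn x) (Q (fst x))"
begin

lemma weight_single [simp]: "weight f [x] = f x"
  by (simp add: weight_def)

text \<open>Uniformity of the bound in the degree is what makes the double family in the inversion summable.\<close>

lemma Qd_bounded:
  assumes "R \<in> D"
  shows "\<exists>c. \<forall>y\<in>{R} \<times> UNIV. fls_ge c (Qd y)"
  using assms
proof (induction "n R" arbitrary: R rule: less_induct)
  case less
  have "finite {g \<in> summands R. n g < n R}"
    by (rule finite_subset[rotated, OF finite_summands[OF less.prems]]) (auto simp: summands_def)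
  then have "\<exists>c\<le>0. \<forall>g\<in>{g \<in> summands R. n g < n R}. \<forall>y\<in>{g} \<times> UNIV. fls_ge c (Qd y)"
    by (rule fls_ge_uniform) (use less.hyps in \<open>auto simp: summands_def\<close>)
  then obtain c where c: "c \<le> 0" "\<And>g d. g \<in> summands R \<Longrightarrow> n g < n R \<Longrightarrow> fls_ge c (Qd (g, d))"
    by auto
  obtain b where b: "\<And>d xs. xs \<in> hn (R, d) \<Longrightarrow> b \<le> psum euler xs"
    using psum_hn_lower_bound[OF less.prems] by auto
  obtain q where q: "fls_ge q (Q R)" using ex_fls_ge by blast
  \<comment> \<open>Here q bounds the left side \<open>Q R\<close>, and the other bound covers every
    term with at least two factors; neither depends on d.\<close>
  define c' where "c' = min q (b + int (n R) * c)"
  have rest: "fls_ge c' (weight Qd xs)" if xs: "xs \<in> hn (R, d)" "xs \<noteq> [(R, d)]" for xs d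
  proof -
    have E: "set xs \<subseteq> E" "sum_list xs = (R, d)" using xs by (auto simp: hn_def)
    have "length xs \<noteq> 1" "xs \<noteq> []" using xs hn_length_1[OF xs(1)] by (auto simp: hn_def)
    then have "1 < length xs" by (cases xs) auto
    then have "fls_ge c (Qd x)" if "x \<in> set xs" for x
      using that E c(2)[of "fst x" "snd x"] fst_in_summands[of x xs] n_summand_less[of x xs] by simp
    then have "fls_ge (b + int (n R) * c) (weight Qd xs)"
      using b[OF xs(1)] c(1) length_le_n[OF E(1)] E(2) by (intro weight_ge) auto
    then show ?thesis by (rule fls_ge_mono) (simp add: c'_def)
  qed
  have "fls_ge c' (Qd (R, d))" for d
  proof -
    have RE: "(R, d) \<in> E" using less.prems by (simp add: E_def)
    obtain F where F: "finite F" "F \<subseteq> hn (R, d)" "\<And>F'. finite F' \<Longrightarrow> F \<subseteq> F' \<Longrightarrow>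
        F' \<subseteq> hn (R, d) \<Longrightarrow> fls_ge c' (Q R - sum (weight Qd) F')"
      using recursion[OF RE] by (rule fls_sumsE[where N = c']) (rule that; simp)
    \<comment> \<open>The singleton term, whose weight is \<open>Qd (R, d)\<close> itself, is
      isolated. All other parts of the truncated identity have order at least c'.\<close>
    define F' where "F' = F - {[(R, d)]}"
    have "fls_ge c' (Q R - sum (weight Qd) (insert [(R, d)] F'))"
      using F single_in_hn[OF RE] by (intro F) (auto simp: F'_def)
    moreover have "sum (weight Qd) (insert [(R, d)] F') = Qd (R, d) + sum (weight Qd) F'"
      using F by (subst sum.insert) (simp_all add: F'_def)
    ultimately have "fls_ge c' (Q R - (Qd (R, d) + sum (weight Qd) F'))"
      by (simp only:)
    moreover have "fls_ge c' (Q R)" using q by (rule fls_ge_mono) (simp add: c'_def)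
    moreover have "fls_ge c' (sum (weight Qd) F')"
      using F rest by (intro fls_ge_sum) (auto simp: F'_def)
    ultimately have "fls_ge c' ((Q R - sum (weight Qd) F') - (Q R - (Qd (R, d) + sum (weight Qd) F')))"
      using fls_ge_diff by blast
    then show ?thesis by simp
  qed
  then show ?case by auto
qed

lemma weight_hn_bounded:
  assumes "R \<in> D"
  shows "\<exists>c. \<forall>xs\<in>(\<Union>d. hn (R, d)). fls_ge c (weight Qd xs)"
proof -
  have "finite (summands R)"
    using finite_summands[OF assms] by (simp add: summands_def)
  then have "\<exists>c\<le>0. \<forall>g\<in>summands R. \<forall>y\<in>{g} \<times> UNIV. fls_ge c (Qd y)"
    by (rule fls_ge_uniform) (use Qd_bounded in \<open>auto simp: summands_def\<close>)
  then obtain c where c: "c \<le> 0" "\<And>g d. g \<in> summands R \<Longrightarrow> fls_ge c (Qd (g, d))"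
    by auto
  obtain b where b: "\<And>d xs. xs \<in> hn (R, d) \<Longrightarrow> b \<le> psum euler xs"
    using psum_hn_lower_bound[OF assms] by auto
  have "fls_ge (b + int (n R) * c) (weight Qd xs)" if xs: "xs \<in> hn (R, d)" for xs d
  proof -
    have E: "set xs \<subseteq> E" "sum_list xs = (R, d)" using xs by (auto simp: hn_def)
    have "fls_ge c (Qd x)" if "x \<in> set xs" for x
      using that E c(2)[of "fst x" "snd x"] fst_in_summands[of x xs] by simp
    then show ?thesis
      using b[OF xs(1)] c(1) length_le_n[OF E(1)] E(2) by (intro weight_ge) auto
  qed
  then show ?thesis by auto
qed

text \<open>Each factor \<open>Q (fst y)\<close> is expanded in the degree \<open>snd y\<close> of
  its own entry, so every concatenation keeps the total of ys.\<close>

lemma sums_weight_concat: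
  assumes "set ys \<subseteq> E"
  shows "fls_sums (\<lambda>xss. (- 1) ^ length ys * weight Qd (concat xss))
    {xss. list_all2 (\<lambda>x xs. xs \<in> hn x) ys xss} ((- 1) ^ length ys * weight (Q \<circ> fst) ys)"
proof -
  have "fls_sums (\<lambda>xss. prod_list (map2 (\<lambda>_. weight Qd) ys xss))
      {xss. list_all2 (\<lambda>x xs. xs \<in> hn x) ys xss} (prod_list (map (Q \<circ> fst) ys))"
    using assms recursion by (intro fls_sums_list_prod) auto
  then have *: "fls_sums (\<lambda>xss. (- 1) ^ length ys * fls_X_intpow (psum euler ys) *
        prod_list (map2 (\<lambda>_. weight Qd) ys xss)) {xss. list_all2 (\<lambda>x xs. xs \<in> hn x) ys xss}
      ((- 1) ^ length ys * fls_X_intpow (psum euler ys) * prod_list (map (Q \<circ> fst) ys))"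
    by (rule fls_sums_cmult)
  have "map2 (\<lambda>_. weight Qd) ys xss = map (weight Qd) xss" if "length ys = length xss" for xss
    using that by (induction ys xss rule: list_induct2) auto
  then have "weight Qd (concat xss) =
      fls_X_intpow (psum euler ys) * prod_list (map2 (\<lambda>_. weight Qd) ys xss)"
    if "list_all2 (\<lambda>x xs. xs \<in> hn x) ys xss" for xss
    using that list_all2_lengthD[OF that] by (simp add: weight_concat list_all2_hn_iff)
  then show ?thesis
    using * by (subst fls_sums_cong) (auto simp: weight_def mult.assoc)
qed

text \<open>The product over the inner blocks has order at least n * c, uniformly in their degrees.
  A term of order below N therefore needs an outer exponent below N - n * c, which leaves finitely
  many ys, and for each of them the inner family is summable.\<close>

lemma null_family_hn_families:
  assumes "x \<in> E" "fls_null_family (\<lambda>ys. fls_X_intpow (psum euler ys) :: 'c fls) (above x)"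
  shows "fls_null_family (\<lambda>(ys, xss). (- 1) ^ length ys * weight Qd (concat xss)) (hn_families x)"
  unfolding fls_null_family_def
proof
  fix N
  have "finite (summands (fst x))"
    using finite_summands[of "fst x"] assms by (auto simp: summands_def E_def)
  then have "\<exists>c\<le>0. \<forall>g\<in>summands (fst x). \<forall>xs\<in>(\<Union>d. hn (g, d)). fls_ge c (weight Qd xs)"
    by (rule fls_ge_uniform) (use weight_hn_bounded in \<open>auto simp: summands_def\<close>)
  then obtain c where c: "c \<le> 0"
    "\<And>g d xs. g \<in> summands (fst x) \<Longrightarrow> xs \<in> hn (g, d) \<Longrightarrow> fls_ge c (weight Qd xs)"
    by auto
  let ?X = "\<lambda>ys. fls_X_intpow (psum euler ys) :: 'c fls"
  let ?f = "\<lambda>ys xss. (- 1) ^ length ys * weight Qd (concat xss)"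
  let ?k = "int (n (fst x))"
  let ?A = "{ys \<in> above x. \<not> fls_ge (N - ?k * c) (?X ys)}"
  let ?B = "\<lambda>ys. {xss \<in> {xss. list_all2 (\<lambda>x xs. xs \<in> hn x) ys xss}. \<not> fls_ge N (?f ys xss)}"
  have sub: "{p \<in> hn_families x. \<not> fls_ge N (case p of (ys, xss) \<Rightarrow> ?f ys xss)} \<subseteq> Sigma ?A ?B"
  proof (rule subrelI)
    fix ys xss assume "(ys, xss) \<in> {p \<in> hn_families x. \<not> fls_ge N (case p of (ys, xss) \<Rightarrow> ?f ys xss)}"
    then have p: "(ys, xss) \<in> hn_families x" "\<not> fls_ge N (?f ys xss)" by auto
    then have ys: "ys \<in> above x" and rel: "list_all2 (\<lambda>x xs. xs \<in> hn x) ys xss"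
      by (auto simp: hn_families_def)
    have E: "set ys \<subseteq> E" "sum_list ys = x" using ys by (auto simp: above_def)
    have "fls_ge c (weight Qd xs)" if "xs \<in> set xss" for xs
    proof -
      from rel that obtain y where y: "y \<in> set ys" "xs \<in> hn y"
        by (metis in_set_conv_nth list_all2_conv_all_nth)
      with c(2)[of "fst y" xs "snd y"] fst_in_summands[of y ys] E show ?thesis by simp
    qed
    then have "fls_ge (int (length (map (weight Qd) xss)) * c) (prod_list (map (weight Qd) xss))"
      by (intro fls_ge_prod_list) auto
    moreover have "?k * c \<le> int (length (map (weight Qd) xss)) * c"
      using length_le_n[OF E(1)] E(2) list_all2_lengthD[OF rel] c(1)
      by (intro mult_right_mono_neg) auto
    ultimately have prod: "fls_ge (?k * c) (prod_list (map (weight Qd) xss))"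
      by (rule fls_ge_mono)
    have "\<not> fls_ge (N - ?k * c) (?X ys)"
    proof
      assume "fls_ge (N - ?k * c) (?X ys)"
      from fls_ge_mult[OF this prod] have "fls_ge N (weight Qd (concat xss))"
        using rel by (simp add: weight_concat list_all2_hn_iff)
      then have "fls_ge (0 + N) (?f ys xss)"
        by (intro fls_ge_mult) (cases "even (length ys)"; simp add: fls_ge_def)
      with p show False by simp
    qed
    with ys rel p show "(ys, xss) \<in> Sigma ?A ?B" by auto
  qed
  have "finite ?A" using assms(2) by (auto simp: fls_null_family_def)
  moreover have "finite (?B ys)" if "ys \<in> above x" for ys
    using fls_sums_imp_null_family[OF sums_weight_concat[of ys]] that
    by (simp add: fls_null_family_def above_def)
  ultimately have "finite (Sigma ?A ?B)" by (intro finite_SigmaI) auto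
  with sub show "finite {p \<in> hn_families x. \<not> fls_ge N (case p of (ys, xss) \<Rightarrow> ?f ys xss)}"
    by (rule finite_subset)
qed

lemma sum_block_ok:
  "(\<Sum>xss\<in>{xss \<in> comps zs. block_ok \<mu> p xss}. (- 1) ^ length xss * c) = of_int (signed_count \<mu> p zs) * (c :: 'c fls)"
proof -
  have "(\<Sum>xss\<in>{xss \<in> comps zs. block_ok \<mu> p xss}. (- 1) ^ length xss * c) =
      (\<Sum>xss\<in>comps zs. (if block_ok \<mu> p xss then (- 1) ^ length xss else 0) * c)"
    by (subst sum.inter_filter[OF finite_comps]) (auto intro!: sum.cong)
  also have "\<dots> = (\<Sum>xss\<in>comps zs. of_int (if block_ok \<mu> p xss then (- 1) ^ length xss else 0)) * c"
    unfolding sum_distrib_right by (intro sum.cong) auto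
  finally show ?thesis by (simp only: signed_count_def of_int_sum)
qed

lemma inversion:
  assumes x: "x \<in> E"
    and null: "fls_null_family (\<lambda>ys. fls_X_intpow (psum euler ys) :: 'c fls) (above x)"
    and s: "fls_sums (\<lambda>ys. (- 1) ^ length ys * weight (Q \<circ> fst) ys) (above x) s"
  shows "s = - Qd x"
proof -
  let ?C = "{zs. zs \<noteq> [] \<and> set zs \<subseteq> E \<and> sum_list zs = x}"
  let ?f = "\<lambda>zs. of_int (signed_count (slope x) 0 zs) * weight Qd zs"
  \<comment> \<open>The null condition serves to pass from the iterated sum to the double one. Going
    back along concatenated lists needs only the finite inner sums over compositions.\<close>
  have "fls_sums (\<lambda>(ys, xss). (- 1) ^ length ys * weight Qd (concat xss)) (hn_families x) s"
    using null_family_hn_families[OF x null] unfolding hn_families_def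
    by (intro fls_sums_Sigma[OF s] sums_weight_concat) (auto simp: above_def)
  then have "fls_sums (\<lambda>(zs, xss). (- 1) ^ length xss * weight Qd zs) (comp_families x) s"
    by (subst fls_sums_bij_betw[OF bij_betw_families]) (auto simp: hn_families_iff)
  moreover have "fls_sums (\<lambda>xss. (- 1) ^ length xss * weight Qd zs)
      {xss \<in> comps zs. block_ok (slope x) 0 xss} (?f zs)" for zs
    unfolding sum_block_ok[symmetric] by (intro fls_sums_finite finite_subset[OF _ finite_comps]) auto
  ultimately have sums1: "fls_sums ?f ?C s"
    unfolding comp_families_def by (rule fls_sums_SigmaD)
  have "height (slope x) x = 0" using height_eq[OF x] by simp
  then have "?f zs = 0" if "zs \<in> ?C - {[x]}" for zs
    using that signed_count_eq_0[of zs "slope x"] by (cases zs; cases "tl zs") auto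
  then have "fls_sums ?f ?C (sum ?f {[x]})"
    using x by (intro fls_sums_finite_support) auto
  with sums1 have "s = sum ?f {[x]}" by (rule fls_sums_unique)
  then show ?thesis by (simp add: signed_count_single)
qed

end

end

section \<open>Geometric sums over cones\<close>

lemma sum_list_take_diffs:
  fixes as :: "int list"
  assumes "k \<le> length as"
  shows "sum_list (take k (map2 (-) as (a # as))) = (a # as) ! k - a"
  using assms
proof (induction as arbitrary: k a)
  case (Cons b as)
  then show ?case by (cases k) simp_all
qed simp

lemma diffs_sum_list_take:
  fixes ds :: "int list"
  defines "as \<equiv> map (\<lambda>k. sum_list (take k ds)) [1..<Suc (length ds)]"
  shows "map2 (-) as (0 # as) = ds"
proof (rule nth_equalityI)
  show "length (map2 (-) as (0 # as)) = length ds" by (simp add: as_def del: upt_Suc)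
  fix i assume "i < length (map2 (-) as (0 # as))"
  then have i: "i < length ds" by (simp add: as_def del: upt_Suc)
  have "(0 # as) ! i = sum_list (take i ds)"
    using i by (cases i) (simp_all add: as_def del: upt_Suc)
  moreover have "as ! i = sum_list (take (Suc i) ds)" "length as = length ds"
    using i by (simp_all add: as_def del: upt_Suc)
  ultimately show "map2 (-) as (0 # as) ! i = ds ! i"
    using i by (simp add: take_Suc_conv_app_nth)
qed

lemma snd_sum_list: "snd (sum_list xs) = sum_list (map snd xs)"
  by (induction xs) simp_all

lemma fst_sum_list: "fst (sum_list xs) = sum_list (map fst xs)"
  by (induction xs) simp_all

lemma prod_list_upt: "prod_list (map f [a..<b]) = (\<Prod>k\<in>{a..<b}. f k)"
  by (simp add: prod.distinct_set_conv_list[symmetric])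

context slope_data
begin

text \<open>The index k is the number of entries before a cut, counted from 1, so the two neighbours
  of the cut have list positions k - 1 and k.\<close>

definition step :: "'g list \<Rightarrow> nat \<Rightarrow> int" where
  "step Rs k = int (n (Rs ! (k - 1)) + n (Rs ! k))"

definition cut :: "real \<Rightarrow> 'g list \<Rightarrow> nat \<Rightarrow> int" where
  "cut \<mu> Rs k = \<lfloor>real (n (sum_list (take k Rs))) * \<mu> - al (sum_list (take k Rs))\<rfloor>"

text \<open>Summation by parts. Appending x of degree e' - e to a list of degree e and rank n adds e
  * n_x - (e' - e) * n, apart from \<open>sg\<close>; combined with the previous boundary term this
  leaves the coefficient n_last + n_x at e.\<close>

lemma psum_euler:
  assumes "ys \<noteq> []"
  shows "psum euler ys = (\<Sum>k=1..<length ys. step (map fst ys) k * snd (sum_list (take k ys)))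
    - int (n (fst (sum_list ys)) - n (fst (last ys))) * snd (sum_list ys) - psum sg (map fst ys)"
  using assms
proof (induction ys rule: rev_induct)
  case (snoc x ys)
  show ?case
  proof (cases "ys = []")
    case False
    let ?r = "length ys"
    let ?f = "\<lambda>ys k. step (map fst ys) k * snd (sum_list (take k ys))"
    have "int (n (fst (last ys))) \<le> int (n (fst (sum_list ys)))"
      using False by (cases ys rule: rev_cases) (simp_all add: n_add)
    then have last: "int (n (fst (sum_list ys)) - n (fst (last ys))) =
        int (n (fst (sum_list ys))) - int (n (fst (last ys)))" by simp
    have "(\<Sum>k=1..<Suc ?r. ?f (ys @ [x]) k) = (\<Sum>k=1..<?r. ?f (ys @ [x]) k) + ?f (ys @ [x]) ?r"
      using False by (simp add: Suc_le_eq)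
    also have "(\<Sum>k=1..<?r. ?f (ys @ [x]) k) = (\<Sum>k=1..<?r. ?f ys k)"
      by (intro sum.cong) (auto simp: step_def nth_append)
    also have "?f (ys @ [x]) ?r = (int (n (fst (last ys))) + int (n (fst x))) * snd (sum_list ys)"
      using False by (simp add: step_def nth_append last_conv_nth)
    finally have 1: "(\<Sum>k=1..<length (ys @ [x]). ?f (ys @ [x]) k) =
        (\<Sum>k=1..<?r. ?f ys k) + (int (n (fst (last ys))) + int (n (fst x))) * snd (sum_list ys)"
      by simp
    have "psum euler (ys @ [x]) = psum euler ys + euler (sum_list ys) x"
      by (simp add: psum_append biadditive_sum_list[OF euler_biadditive])
    moreover have "psum sg (map fst (ys @ [x])) = psum sg (map fst ys) + sg (fst (sum_list ys)) (fst x)"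
      by (simp add: psum_append biadditive_sum_list[OF sg_biadditive] fst_sum_list o_def)
    ultimately show ?thesis
      unfolding 1 using snoc.IH[OF False] unfolding last euler_def
      by (simp add: n_add algebra_simps)
  qed (simp add: n_add)
qed simp

text \<open>Here \<open>es\<close> lists the degrees of the proper initial segments; in these coordinates the summation
  conditions become independent and the exponent becomes linear.\<close>

definition fill :: "int \<Rightarrow> 'g list \<Rightarrow> int list \<Rightarrow> ('g \<times> int) list" where
  "fill d Rs es = zip Rs (map2 (-) (es @ [d]) (0 # es @ [d]))"

lemma fill:
  assumes "Suc (length es) = length Rs"
  shows "length (fill d Rs es) = length Rs" "map fst (fill d Rs es) = Rs"
    "k \<le> length Rs \<Longrightarrow> sum_list (take k (fill d Rs es)) = (sum_list (take k Rs), (0 # es @ [d]) ! k)"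
    "sum_list (fill d Rs es) = (sum_list Rs, d)"
proof -
  let ?ds = "map2 (-) (es @ [d]) (0 # es @ [d])"
  have len: "length ?ds = length Rs" using assms by simp
  then show len': "length (fill d Rs es) = length Rs" and fst: "map fst (fill d Rs es) = Rs"
    unfolding fill_def by (simp_all del: zip_Cons zip_append1)
  have snd: "map snd (fill d Rs es) = ?ds" unfolding fill_def using len by (intro map_snd_zip) simp
  have take: "sum_list (take k (fill d Rs es)) = (sum_list (take k Rs), (0 # es @ [d]) ! k)"
    if "k \<le> length Rs" for k
  proof -
    have "k \<le> length (es @ [d])" using that assms by simp
    then have "snd (sum_list (take k (fill d Rs es))) = (0 # es @ [d]) ! k"
      using sum_list_take_diffs[of k "es @ [d]" 0] by (simp add: snd_sum_list take_map[symmetric] snd)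
    moreover have "fst (sum_list (take k (fill d Rs es))) = sum_list (take k Rs)"
      using fst by (metis fst_sum_list take_map)
    ultimately show ?thesis by (simp add: prod_eq_iff)
  qed
  then show "k \<le> length Rs \<Longrightarrow> sum_list (take k (fill d Rs es)) = (sum_list (take k Rs), (0 # es @ [d]) ! k)" .
  show "sum_list (fill d Rs es) = (sum_list Rs, d)"
    using take[of "length Rs"] len' by (simp add: assms[symmetric])
qed

text \<open>Written with \<open>list_all2\<close> to exhibit it as a product of rays, the form
  needed for a product of geometric series.\<close>

definition cuts :: "real \<Rightarrow> 'g list \<Rightarrow> int list set" where
  "cuts \<mu> Rs = {es. list_all2 (\<lambda>k e. e \<in> {cut \<mu> Rs k<..}) [1..<length Rs] es}"

lemma cuts_iff:
  "Rs \<noteq> [] \<Longrightarrow> es \<in> cuts \<mu> Rs \<longleftrightarrow> Suc (length es) = length Rs \<and>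
     (\<forall>k. 0 < k \<longrightarrow> k < length Rs \<longrightarrow> cut \<mu> Rs k < es ! (k - 1))"
proof -
  assume "Rs \<noteq> []"
  have "(\<forall>i<length Rs - 1. cut \<mu> Rs (Suc i) < es ! i) \<longleftrightarrow>
     (\<forall>k. 0 < k \<longrightarrow> k < length Rs \<longrightarrow> cut \<mu> Rs k < es ! (k - 1))"
    by (metis One_nat_def Suc_less_eq Suc_pred diff_Suc_1 length_greater_0_conv less_diff_conv plus_1_eq_Suc zero_less_Suc add.commute \<open>Rs \<noteq> []\<close>)
  then show ?thesis using \<open>Rs \<noteq> []\<close>
    by (cases Rs) (auto simp: cuts_def list_all2_conv_all_nth simp del: upt_Suc)
qed

text \<open>As e is an integer, exceeding a real bound strictly is the same as exceeding its
  floor.\<close>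

lemma height_pos_iff_cut:
  "0 < height \<mu> (sum_list (take k Rs), e) \<longleftrightarrow> cut \<mu> Rs k < e"
  by (simp add: height_def deg_def cut_def floor_less_iff algebra_simps)

lemma bij_betw_fill:
  assumes "R \<in> D"
  shows "bij_betw (\<lambda>(Rs, es). fill d Rs es) (SIGMA Rs : decomps R. cuts (slope (R, d)) Rs) (above (R, d))"
proof (rule bij_betwI[where g = "\<lambda>ys. (map fst ys, map (\<lambda>k. snd (sum_list (take k ys))) [1..<length ys])"])
  let ?g = "\<lambda>ys. (map fst ys, map (\<lambda>k. snd (sum_list (take k ys))) [1..<length ys])"
  have fwd: "fill d Rs es \<in> above (R, d) \<and> ?g (fill d Rs es) = (Rs, es)"
    if Rs: "Rs \<in> decomps R" and es: "es \<in> cuts (slope (R, d)) Rs" for Rs es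
  proof
    have ne: "Rs \<noteq> []" using Rs by (auto simp: decomps_def)
    have len: "Suc (length es) = length Rs"
      and cut: "\<And>k. 0 < k \<Longrightarrow> k < length Rs \<Longrightarrow> cut (slope (R, d)) Rs k < es ! (k - 1)"
      using es cuts_iff[OF ne] by auto
    note fill = fill[OF len]
    \<comment> \<open>Position k of \<open>0 # es @ [d]\<close> is the degree of the first k
      entries: 0 belongs to the empty segment and d to the whole list.\<close>
    have nth: "(0 # es @ [d]) ! k = es ! (k - 1)" if "0 < k" "k < length Rs" for k
      using that len by (cases k) (auto simp: nth_append)
    have "set (fill d Rs es) \<subseteq> E"
    proof
      fix x assume "x \<in> set (fill d Rs es)"
      then have "fst x \<in> set (map fst (fill d Rs es))" by simp
      then show "x \<in> E" unfolding fill(2) using Rs by (cases x) (auto simp: decomps_def E_def)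
    qed
    moreover have "sum_list (fill d Rs es) = (R, d)"
      using Rs by (simp add: fill(4) decomps_def)
    ultimately show "fill d Rs es \<in> above (R, d)"
      unfolding above_def using ne fill(1)[of d] fill(3) cut nth by (auto simp: height_pos_iff_cut)
    have "map (\<lambda>k. snd (sum_list (take k (fill d Rs es)))) [1..<length Rs] = es"
      by (rule nth_equalityI) (use len in \<open>auto simp: fill(3) nth_append\<close>)
    then show "?g (fill d Rs es) = (Rs, es)" using fill by simp
  qed
  show "(\<lambda>(Rs, es). fill d Rs es) \<in> (SIGMA Rs : decomps R. cuts (slope (R, d)) Rs) \<rightarrow> above (R, d)"
    using fwd by auto
  show "?g ((\<lambda>(Rs, es). fill d Rs es) p) = p" if "p \<in> (SIGMA Rs : decomps R. cuts (slope (R, d)) Rs)" for p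
    using fwd that by auto
  have bwd: "?g ys \<in> (SIGMA Rs : decomps R. cuts (slope (R, d)) Rs)
      \<and> fill d (map fst ys) (map (\<lambda>k. snd (sum_list (take k ys))) [1..<length ys]) = ys"
    if ys: "ys \<in> above (R, d)" for ys
  proof
    have ne: "ys \<noteq> []" and E: "set ys \<subseteq> E" and sum: "sum_list ys = (R, d)"
      and pos: "\<And>k. 0 < k \<Longrightarrow> k < length ys \<Longrightarrow> 0 < height (slope (R, d)) (sum_list (take k ys))"
      using ys by (auto simp: above_def)
    have "map fst ys \<in> decomps R"
      using ne E sum fst_sum_list[of ys] by (auto simp: decomps_def E_def)
    moreover have "cut (slope (R, d)) (map fst ys) k < snd (sum_list (take k ys))"
      if "0 < k" "k < length ys" for k
    proof -
      have "sum_list (take k ys) = (sum_list (take k (map fst ys)), snd (sum_list (take k ys)))"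
        by (simp add: prod_eq_iff fst_sum_list take_map)
      then show ?thesis using pos[OF that] height_pos_iff_cut by metis
    qed
    ultimately show "?g ys \<in> (SIGMA Rs : decomps R. cuts (slope (R, d)) Rs)"
      using ne by (auto simp: cuts_iff)
    have "map (\<lambda>k. snd (sum_list (take k ys))) [1..<length ys] @ [d] =
        map (\<lambda>k. sum_list (take k (map snd ys))) [1..<Suc (length (map snd ys))]"
      using ne sum snd_sum_list[of ys] by (simp add: snd_sum_list take_map Suc_le_eq)
    then show "fill d (map fst ys) (map (\<lambda>k. snd (sum_list (take k ys))) [1..<length ys]) = ys"
      unfolding fill_def using diffs_sum_list_take[of "map snd ys"] by (simp only: zip_map_fst_snd)
  qed
  show "?g \<in> above (R, d) \<rightarrow> (SIGMA Rs : decomps R. cuts (slope (R, d)) Rs)"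
    using bwd by blast
  show "(\<lambda>(Rs, es). fill d Rs es) (?g ys) = ys" if "ys \<in> above (R, d)" for ys
    using bwd[OF that] by simp
qed

text \<open>The part of the exponent that is constant on the cone. It is \<open>M'_R\<close> without
  the bracket 2n(R) - n(R_1) - n(R_r).\<close>

definition cone_exponent :: "int \<Rightarrow> 'g list \<Rightarrow> int" where
  "cone_exponent d Rs = - (int (n (sum_list Rs)) - int (n (last Rs))) * d - psum sg Rs"

lemma psum_euler_fill:
  assumes "Rs \<noteq> []" "Suc (length es) = length Rs"
  shows "psum euler (fill d Rs es) =
    cone_exponent d Rs + (\<Sum>k=1..<length Rs. step Rs k * es ! (k - 1))"
proof -
  note fill = fill[OF assms(2)]
  have ne: "fill d Rs es \<noteq> []" using fill(1)[of d] assms(1) by auto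
  have "sum_list (fill d Rs es) = (sum_list Rs, d)"
    by (rule fill(4))
  moreover have "fst (last (fill d Rs es)) = last Rs"
    using last_map[OF ne, of fst] fill(2)[of d] by simp
  moreover have "n (last Rs) \<le> n (sum_list Rs)"
    using assms(1) by (cases Rs rule: rev_cases) (simp_all add: n_add)
  moreover have "(\<Sum>k=1..<length Rs. step Rs k * snd (sum_list (take k (fill d Rs es)))) =
      (\<Sum>k=1..<length Rs. step Rs k * es ! (k - 1))"
    by (rule sum.cong[OF refl]) (use assms in \<open>auto simp: fill(3) nth_append nth_Cons'\<close>)
  ultimately show ?thesis
    unfolding psum_euler[OF ne] fill by (simp add: cone_exponent_def of_nat_diff left_diff_distrib)
qed

definition cone_sum :: "int \<Rightarrow> real \<Rightarrow> 'g list \<Rightarrow> 'c::field fls" where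
  "cone_sum d \<mu> Rs = fls_X_intpow (cone_exponent d Rs) *
     (\<Prod>k=1..<length Rs. - fls_X_intpow (step Rs k * (cut \<mu> Rs k + 1)) / (fls_X_intpow (step Rs k) - 1))"

lemma fls_X_intpow_sum:
  "fls_X_intpow (\<Sum>x\<in>A. f x) = (\<Prod>x\<in>A. fls_X_intpow (f x) :: 'c::comm_ring_1 fls)"
proof (induction A rule: infinite_finite_induct)
  case (insert x A)
  have "fls_X_intpow (\<Sum>x\<in>insert x A. f x) = (fls_X_intpow (f x + sum f A) :: 'c fls)"
    using insert by simp
  also have "\<dots> = fls_X_intpow (f x) * fls_X_intpow (sum f A)"
    by (rule fls_X_intpow_times_fls_X_intpow[symmetric])
  also have "\<dots> = (\<Prod>x\<in>insert x A. fls_X_intpow (f x))"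
    using insert by simp
  finally show ?case .
qed simp_all

lemma sums_cone:
  assumes Rs: "Rs \<noteq> []" "set Rs \<subseteq> D"
  shows "fls_sums (\<lambda>es. fls_X_intpow (psum euler (fill d Rs es))) (cuts \<mu> Rs)
    (cone_sum d \<mu> Rs :: 'c::field fls)"
proof -
  let ?f = "\<lambda>k e. fls_X_intpow (step Rs k * e) :: 'c fls"
  have "fls_sums (\<lambda>es. prod_list (map2 ?f [1..<length Rs] es)) (cuts \<mu> Rs)
    (prod_list (map (\<lambda>k. - fls_X_intpow (step Rs k * (cut \<mu> Rs k + 1)) /
       (fls_X_intpow (step Rs k) - 1)) [1..<length Rs]))"
    unfolding cuts_def
  proof (rule fls_sums_list_prod)
    fix k assume "k \<in> set [1..<length Rs]"
    then have "Rs ! k \<in> set Rs" by simp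
    then have "0 < n (Rs ! k)" using Rs n_pos by blast
    then have "0 < step Rs k" by (simp add: step_def)
    then show "fls_sums (?f k) {cut \<mu> Rs k<..} (- fls_X_intpow (step Rs k * (cut \<mu> Rs k + 1)) /
       (fls_X_intpow (step Rs k) - 1))" by (rule fls_sums_geometric)
  qed
  from fls_sums_cmult[OF this, of "fls_X_intpow (cone_exponent d Rs)"]
  have *: "fls_sums (\<lambda>es. fls_X_intpow (cone_exponent d Rs) * prod_list (map2 ?f [1..<length Rs] es))
      (cuts \<mu> Rs) (cone_sum d \<mu> Rs)"
    unfolding prod_list_upt cone_sum_def .
  have eq: "fls_X_intpow (psum euler (fill d Rs es)) =
      fls_X_intpow (cone_exponent d Rs) * prod_list (map2 ?f [1..<length Rs] es)"
    if "es \<in> cuts \<mu> Rs" for es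
  proof -
    have len: "Suc (length es) = length Rs" using that cuts_iff[OF Rs(1)] by blast
    have "map2 ?f [1..<length Rs] es = map (\<lambda>k. ?f k (es ! (k - 1))) [1..<length Rs]"
      by (rule nth_equalityI) (use len in auto)
    then show ?thesis
      unfolding psum_euler_fill[OF Rs(1) len] prod_list_upt[symmetric] fls_X_intpow_times_fls_X_intpow[symmetric]
        fls_X_intpow_sum by (simp only: prod_list_upt)
  qed
  show ?thesis using * by (subst fls_sums_cong[OF eq]) auto
qed

end

section \<open>The inversion formula in closed form\<close>

context slope_data
begin

lemma n_sum_list: "n (sum_list gs) = (\<Sum>g\<leftarrow>gs. n g)"
  by (induction gs) (simp_all add: n_add)

text \<open>There are finitely many lists of data, with one cone for each. The case c = 1 gives the
  null condition required by \<open>inversion\<close>; the signed products of \<open>Q\<close> give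
  the sum to be inverted.\<close>

lemma sums_above:
  fixes c :: "'g list \<Rightarrow> 'c::field fls"
  assumes "R \<in> D"
  shows "fls_sums (\<lambda>ys. c (map fst ys) * fls_X_intpow (psum euler ys)) (above (R, d))
    (\<Sum>Rs\<in>decomps R. c Rs * cone_sum d (slope (R, d)) Rs)"
proof -
  let ?\<mu> = "slope (R, d)"
  let ?g = "\<lambda>Rs es. c Rs * fls_X_intpow (psum euler (fill d Rs es))"
  have inner: "fls_sums (?g Rs) (cuts ?\<mu> Rs) (c Rs * cone_sum d ?\<mu> Rs)" if "Rs \<in> decomps R" for Rs
    using that by (intro fls_sums_cmult sums_cone) (auto simp: decomps_def)
  have "fls_sums (\<lambda>(Rs, es). ?g Rs es) (SIGMA Rs : decomps R. cuts ?\<mu> Rs)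
      (\<Sum>Rs\<in>decomps R. c Rs * cone_sum d ?\<mu> Rs)"
    using finite_decomps[OF assms] inner fls_sums_imp_null_family[OF inner]
    by (intro fls_sums_Sigma[OF fls_sums_finite inner fls_null_family_Sigma_finite])
  moreover have "map fst (fill d Rs es) = Rs" if "Rs \<in> decomps R" "es \<in> cuts ?\<mu> Rs" for Rs es
    using that fill(2)[of es Rs] cuts_iff[of Rs] by (auto simp: decomps_def)
  ultimately show ?thesis
    by (subst fls_sums_bij_betw[OF bij_betw_fill[OF assms]]) auto
qed

lemma cone_sum_closed_form:
  assumes "Rs \<noteq> []"
  shows "- ((- 1) ^ length Rs * cone_sum d \<mu> Rs) =
    fls_X_intpow (cone_exponent d Rs + (\<Sum>k=1..<length Rs. step Rs k * (cut \<mu> Rs k + 1))) /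
      (\<Prod>k=1..<length Rs. fls_X_intpow (step Rs k) - (1 :: 'c::field fls))"
proof -
  let ?A = "\<lambda>k. fls_X_intpow (step Rs k * (cut \<mu> Rs k + 1)) :: 'c fls"
  let ?B = "\<lambda>k. fls_X_intpow (step Rs k) - 1 :: 'c fls"
  have "(\<Prod>k=1..<length Rs. - ?A k / ?B k) = (\<Prod>k=1..<length Rs. (- 1) * (?A k / ?B k))"
    by simp
  also have "\<dots> = (- 1) ^ (length Rs - 1) * ((\<Prod>k=1..<length Rs. ?A k) / (\<Prod>k=1..<length Rs. ?B k))"
    unfolding prod.distrib prod_dividef by simp
  finally have "- ((- 1) ^ length Rs * cone_sum d \<mu> Rs) =
      - ((- 1) ^ length Rs * (- 1) ^ (length Rs - 1)) *
      (fls_X_intpow (cone_exponent d Rs) * (\<Prod>k=1..<length Rs. ?A k) / (\<Prod>k=1..<length Rs. ?B k))"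
    unfolding cone_sum_def by simp
  \<comment> \<open>The exponents r and r - 1 have odd sum; the list is nonempty, so r - 1 is not
    truncated.\<close>
  also have "- ((- 1) ^ length Rs * (- 1) ^ (length Rs - 1)) = (1 :: 'c fls)"
    using assms by (cases Rs) (simp_all flip: power_add mult_2)
  also have "fls_X_intpow (cone_exponent d Rs) * (\<Prod>k=1..<length Rs. ?A k) =
      fls_X_intpow (cone_exponent d Rs + (\<Sum>k=1..<length Rs. step Rs k * (cut \<mu> Rs k + 1)))"
    unfolding fls_X_intpow_sum[symmetric] by (rule fls_X_intpow_times_fls_X_intpow)
  finally show ?thesis by (simp only: mult_1_left)
qed

theorem inversion_closed_form:
  fixes Qd :: "'g \<times> int \<Rightarrow> 'c::field fls" and Q :: "'g \<Rightarrow> 'c fls"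
  assumes recursion: "\<And>x. x \<in> E \<Longrightarrow> fls_sums (weight Qd) (hn x) (Q (fst x))"
    and R: "R \<in> D"
  shows "Qd (R, d) = (\<Sum>Rs\<in>decomps R.
    fls_X_intpow (cone_exponent d Rs + (\<Sum>k=1..<length Rs. step Rs k * (cut (slope (R, d)) Rs k + 1))) /
      (\<Prod>k=1..<length Rs. fls_X_intpow (step Rs k) - 1) * prod_list (map Q Rs))"
proof -
  let ?\<mu> = "slope (R, d)"
  have x: "(R, d) \<in> E" using R by (simp add: E_def)
  have null: "fls_null_family (\<lambda>ys. fls_X_intpow (psum euler ys) :: 'c fls) (above (R, d))"
    using fls_sums_imp_null_family[OF sums_above[OF R, of "\<lambda>_. 1"]] by simp
  let ?c = "\<lambda>Rs. (- 1) ^ length Rs * prod_list (map Q Rs)"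
  have "(\<lambda>ys. ?c (map fst ys) * fls_X_intpow (psum euler ys)) = (\<lambda>ys. (- 1) ^ length ys * weight (Q \<circ> fst) ys)"
    by (simp add: weight_def mult_ac)
  with sums_above[OF R, of ?c d]
  have "fls_sums (\<lambda>ys. (- 1) ^ length ys * weight (Q \<circ> fst) ys) (above (R, d))
      (\<Sum>Rs\<in>decomps R. ?c Rs * cone_sum d ?\<mu> Rs)" by (simp only:)
  from inversion[OF recursion x null this]
  have "Qd (R, d) = - (\<Sum>Rs\<in>decomps R. ?c Rs * cone_sum d ?\<mu> Rs)" by simp
  also have "\<dots> = (\<Sum>Rs\<in>decomps R. - ((- 1) ^ length Rs * cone_sum d ?\<mu> Rs) * prod_list (map Q Rs))"
    by (simp add: sum_negf mult_ac)
  also have "\<dots> = (\<Sum>Rs\<in>decomps R.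
    fls_X_intpow (cone_exponent d Rs + (\<Sum>k=1..<length Rs. step Rs k * (cut ?\<mu> Rs k + 1))) /
      (\<Prod>k=1..<length Rs. fls_X_intpow (step Rs k) - 1) * prod_list (map Q Rs))"
    (is "(\<Sum>Rs\<in>_. ?L Rs) = (\<Sum>Rs\<in>_. ?R Rs)")
  proof (rule sum.cong[OF refl])
    fix Rs assume "Rs \<in> decomps R"
    then have "Rs \<noteq> []" by (simp add: decomps_def)
    show "?L Rs = ?R Rs" unfolding cone_sum_closed_form[OF \<open>Rs \<noteq> []\<close>] by (rule refl)
  qed
  finally show ?thesis .
qed

end

section \<open>Partitions as lists of data\<close>

text \<open>Bridges the indexing by 1, ..., r in the theorem and list positions, which start at
  0.\<close>

definition tabulate :: "(nat \<Rightarrow> 'a) \<Rightarrow> nat \<Rightarrow> 'a list" where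
  "tabulate f r = map f [1..<Suc r]"

lemma length_tabulate [simp]: "length (tabulate f r) = r"
  by (simp add: tabulate_def del: upt_Suc)

lemma nth_tabulate [simp]: "i < r \<Longrightarrow> tabulate f r ! i = f (Suc i)"
  by (simp add: tabulate_def del: upt_Suc)

lemma set_tabulate: "set (tabulate f r) = f ` {1..r}"
  by (simp add: tabulate_def atLeastLessThanSuc_atLeastAtMost del: upt_Suc)

lemma map_tabulate: "map g (tabulate f r) = tabulate (g \<circ> f) r"
  by (simp add: tabulate_def del: upt_Suc)

lemma take_tabulate: "k \<le> r \<Longrightarrow> take k (tabulate f r) = tabulate f k"
  by (rule nth_equalityI) simp_all

lemma sum_list_tabulate: "sum_list (tabulate f r) = (\<Sum>k=1..r. f k)"
  unfolding tabulate_def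
  by (simp only: interv_sum_list_conv_sum_set_nat set_upt atLeastLessThanSuc_atLeastAtMost)

lemma prod_list_tabulate: "prod_list (tabulate f r) = (\<Prod>k=1..r. f k)"
  unfolding tabulate_def by (simp only: prod_list_upt atLeastLessThanSuc_atLeastAtMost)

lemma psum_tabulate:
  "psum \<phi> (tabulate f r) = (\<Sum>k=1..r. \<Sum>l=1..r. if k > l then \<phi> (f l) (f k) else 0)"
  unfolding tabulate_def psum_map psum_upt by (rule refl)

lemma sum_fun_apply: "(\<Sum>k\<in>A. f k) x = (\<Sum>k\<in>A. f k x)"
  for f :: "_ \<Rightarrow> _ \<Rightarrow> 'b::comm_monoid_add"
  by (induction A rule: infinite_finite_induct) simp_all

text \<open>The first argument is the earlier part: in \<sigma> the larger weight index i goes with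
  the later part, here h.\<close>

definition data_sigma ::
  "'p set \<Rightarrow> ('p \<Rightarrow> nat) \<Rightarrow> ('p \<Rightarrow> nat \<Rightarrow> nat) \<Rightarrow> ('p \<Rightarrow> nat \<Rightarrow> nat) \<Rightarrow> int" where
  "data_sigma S m g h =
     (\<Sum>P\<in>S. \<Sum>i=1..m P. \<Sum>t=1..m P. if i > t then int (h P i * g P t) else 0)"

lemma rank_at_add: "rank_at m (g + h) P = rank_at m g P + rank_at m h P"
  by (simp add: rank_at_def sum.distrib)

lemma le_rank_at: "i \<in> {1..m P} \<Longrightarrow> R P i \<le> rank_at m R P"
  unfolding rank_at_def by (rule member_le_sum) auto

lemma is_data_zero:
  assumes "is_data S m g" "P \<notin> S \<or> i < 1 \<or> m P < i"
  shows "g P i = 0"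
  by (rule assms(1)[unfolded is_data_def, THEN conjunct1, rule_format, OF assms(2)])

lemma is_data_add:
  assumes "is_data S m g" "is_data S m h"
  shows "is_data S m (g + h)"
proof -
  obtain a b where "0 < a" "\<forall>P\<in>S. rank_at m g P = a" "0 < b" "\<forall>P\<in>S. rank_at m h P = b"
    using assms unfolding is_data_def by auto
  then have "0 < a + b \<and> (\<forall>P\<in>S. rank_at m (g + h) P = a + b)" by (simp add: rank_at_add)
  then show ?thesis
    unfolding is_data_def using is_data_zero[OF assms(1)] is_data_zero[OF assms(2)] by auto
qed

lemma finite_is_data_le:
  assumes "finite S" "is_data S m R"
  shows "finite {g. is_data S m g \<and> (\<forall>P i. g P i \<le> R P i)}"
proof -
  obtain n where n: "\<And>P. P \<in> S \<Longrightarrow> rank_at m R P = n" using assms(2) by (auto simp: is_data_def)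
  \<comment> \<open>A common bound for all \<open>m P\<close> lets every \<open>g P\<close> lie in
    the single finite set \<open>?B\<close>; its values are bounded by the rank of R.\<close>
  define M where "M = (\<Sum>P\<in>S. m P)"
  let ?B = "{f. \<forall>i. (i \<in> {..M} \<longrightarrow> f i \<in> {..n}) \<and> (i \<notin> {..M} \<longrightarrow> f i = 0)}"
  have fin: "finite ?B" by (rule finite_set_of_finite_funs) simp_all
  let ?T = "{g. \<forall>P. (P \<in> S \<longrightarrow> g P \<in> ?B) \<and> (P \<notin> S \<longrightarrow> g P = (\<lambda>_. 0))}"
  have "{g. is_data S m g \<and> (\<forall>P i. g P i \<le> R P i)} \<subseteq> ?T"
  proof
    fix g assume "g \<in> {g. is_data S m g \<and> (\<forall>P i. g P i \<le> R P i)}"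
    then have g: "is_data S m g" "\<And>P i. g P i \<le> R P i" by simp_all
    have zero: "g P i = 0" if "P \<notin> S \<or> i < 1 \<or> m P < i" for P i
      by (rule is_data_zero[OF g(1) that])
    have "g P i \<le> n" if "P \<in> S" for P i
    proof (cases "i \<in> {1..m P}")
      case True
      then show ?thesis using le_rank_at[of i m P R] n[OF that] g(2) le_trans by metis
    qed (use zero in auto)
    moreover have "m P \<le> M" if "P \<in> S" for P
      unfolding M_def using assms(1) that by (intro member_le_sum) auto
    then have "g P i = 0" if "P \<in> S" "M < i" for P i
      using zero[of P i] le_less_trans[of "m P" M i] that by simp
    moreover have "g P = (\<lambda>_. 0)" if "P \<notin> S" for P
      using zero that by (intro ext) simp
    ultimately show "g \<in> ?T" by simp
  qed
  moreover have "finite ?T" by (rule finite_set_of_finite_funs[OF assms(1) fin])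
  ultimately show ?thesis by (rule finite_subset)
qed

lemma data_slope_data:
  assumes "finite S" "S \<noteq> {}"
  shows "slope_data {R. is_data S m R} (data_n S m) (data_alpha S m al) (data_sigma S m)"
proof
  have P: "(SOME P. P \<in> S) \<in> S" using assms(2) some_in_eq by blast
  fix g h R
  show "data_n S m (g + h) = data_n S m g + data_n S m h"
    by (simp add: data_n_def rank_at_add)
  show "data_alpha S m al (g + h) = data_alpha S m al g + data_alpha S m al h"
    by (simp add: data_alpha_def sum.distrib ring_distribs)
  show "0 < data_n S m g" if "g \<in> {R. is_data S m R}"
    using that P by (auto simp: data_n_def is_data_def)
  show "g + h \<in> {R. is_data S m R}" if "g \<in> {R. is_data S m R}" "h \<in> {R. is_data S m R}"
    using that by (simp add: is_data_add)
  show "biadditive (data_sigma S m)"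
    unfolding biadditive_def data_sigma_def sum.distrib[symmetric]
    by (intro allI conjI sum.cong refl) (simp_all add: ring_distribs)
  show "finite {g \<in> {R. is_data S m R}. \<exists>h. g + h = R}" if "R \<in> {R. is_data S m R}"
    using that by (intro finite_subset[OF _ finite_is_data_le[OF assms(1)]]) auto
qed

text \<open>A nonzero entry in column k makes its common rank positive, so that the column is a
  datum. Conversely, a positive rank at some point of the nonempty S forces a nonzero entry
  there.\<close>

lemma is_partition_iff:
  assumes "S \<noteq> {}" "is_data S m R"
  shows "is_partition S m R r I \<longleftrightarrow> (\<forall>P i k. k < 1 \<or> r < k \<longrightarrow> I P i k = 0) \<and>
    (\<forall>k\<in>{1..r}. is_data S m (part_k I k)) \<and> sum_list (tabulate (part_k I) r) = R"
    (is "?L \<longleftrightarrow> ?R")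
proof
  assume L: ?L
  have zero: "I P i k = 0" if "P \<notin> S \<or> i < 1 \<or> m P < i \<or> k < 1 \<or> r < k" for P i k
    by (rule L[unfolded is_partition_def, THEN conjunct1, rule_format, OF that])
  note sums = L[unfolded is_partition_def, THEN conjunct2, THEN conjunct1, rule_format]
  note ranks = L[unfolded is_partition_def, THEN conjunct2, THEN conjunct2, THEN conjunct1, rule_format]
  note nonzero = L[unfolded is_partition_def, THEN conjunct2, THEN conjunct2, THEN conjunct2, rule_format]
  have "is_data S m (part_k I k)" if k: "k \<in> {1..r}" for k
  proof -
    obtain c where c: "\<forall>P\<in>S. (\<Sum>i=1..m P. I P i k) = c" using ranks[OF k] by (elim exE)
    obtain P i where "P \<in> S" "i \<in> {1..m P}" "I P i k \<noteq> 0" using nonzero[OF k] by (elim bexE)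
    then have "0 < c"
      using c le_rank_at[of i m P "part_k I k"] by (simp add: rank_at_def part_k_def)
    then show ?thesis using c zero unfolding is_data_def rank_at_def part_k_def
      by (intro conjI allI impI exI[of _ c]) auto
  qed
  moreover have "(\<Sum>k=1..r. I P i k) = R P i" for P i
  proof (cases "P \<in> S \<and> i \<in> {1..m P}")
    case True
    then show ?thesis using sums by simp
  next
    case False
    then have "P \<notin> S \<or> i < 1 \<or> m P < i" by auto
    then have "R P i = 0" "\<And>k. I P i k = 0" using is_data_zero[OF assms(2)] zero by auto
    then show ?thesis by simp
  qed
  then have "sum_list (tabulate (part_k I) r) = R"
    by (intro ext) (simp add: sum_list_tabulate sum_fun_apply part_k_def)
  ultimately show ?R using zero by simp
next
  assume R: ?R
  have zero: "I P i k = 0" if "P \<notin> S \<or> i < 1 \<or> m P < i" for P i k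
  proof (cases "k \<in> {1..r}")
    case True
    then have "is_data S m (part_k I k)" using R by simp
    from is_data_zero[OF this that] show ?thesis by (simp add: part_k_def)
  next
    case False
    then have "k < 1 \<or> r < k" by auto
    then show ?thesis by (rule R[THEN conjunct1, rule_format])
  qed
  have "(\<Sum>k=1..r. I P i k) = R P i" for P i
    using R by (auto simp: sum_list_tabulate sum_fun_apply part_k_def)
  moreover have "(\<exists>c. \<forall>P\<in>S. (\<Sum>i=1..m P. I P i k) = c) \<and> (\<exists>P\<in>S. \<exists>i\<in>{1..m P}. I P i k \<noteq> 0)"
    if "k \<in> {1..r}" for k
  proof
    have "is_data S m (part_k I k)" using R that by simp
    then obtain c where c: "0 < c" "\<forall>P\<in>S. (\<Sum>i=1..m P. I P i k) = c"
      unfolding is_data_def rank_at_def part_k_def by auto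
    then show "\<exists>c. \<forall>P\<in>S. (\<Sum>i=1..m P. I P i k) = c" by blast
    obtain P where "P \<in> S" using assms(1) by blast
    then have "(\<Sum>i=1..m P. I P i k) \<noteq> 0" using c by simp
    then obtain i where "i \<in> {1..m P}" "I P i k \<noteq> 0" by (rule sum.not_neutral_contains_not_neutral)
    with \<open>P \<in> S\<close> show "\<exists>P\<in>S. \<exists>i\<in>{1..m P}. I P i k \<noteq> 0" by blast
  qed
  ultimately show ?L using R zero unfolding is_partition_def by auto
qed

lemma sigma_R_eq: "sigma_R S m r I = psum (data_sigma S m) (tabulate (part_k I) r)"
proof -
  let ?f = "\<lambda>P k l. \<Sum>i=1..m P. \<Sum>t=1..m P. if i > t then int (I P i k * I P t l) else 0"
  have "sigma_R S m r I = (\<Sum>P\<in>S. \<Sum>k=1..r. \<Sum>l=1..r. if k > l then ?f P k l else 0)"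
    unfolding sigma_R_def by (intro sum.cong refl) simp
  also have "\<dots> = (\<Sum>k=1..r. \<Sum>l=1..r. \<Sum>P\<in>S. if k > l then ?f P k l else 0)"
    by (subst sum.swap) (rule sum.cong[OF refl], rule sum.swap)
  also have "\<dots> = (\<Sum>k=1..r. \<Sum>l=1..r. if k > l then \<Sum>P\<in>S. ?f P k l else 0)"
    by (intro sum.cong refl) simp
  finally show ?thesis by (simp only: psum_tabulate data_sigma_def part_k_def)
qed

text \<open>The value 0 outside the range matches the support condition on partitions, so the
  inverse is exact.\<close>

definition untabulate :: "('p \<Rightarrow> nat \<Rightarrow> nat) list \<Rightarrow> 'p \<Rightarrow> nat \<Rightarrow> nat \<Rightarrow> nat" where
  "untabulate Rs P i k = (if 1 \<le> k \<and> k \<le> length Rs then (Rs ! (k - 1)) P i else 0)"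

lemma tabulate_untabulate: "tabulate (part_k (untabulate Rs)) (length Rs) = Rs"
  by (rule nth_equalityI) (simp_all add: part_k_def untabulate_def)

lemma untabulate_tabulate:
  assumes "\<And>P i k. k < 1 \<or> r < k \<Longrightarrow> I P i k = 0"
  shows "untabulate (tabulate (part_k I) r) = I"
proof (intro ext)
  fix P i k
  show "untabulate (tabulate (part_k I) r) P i k = I P i k"
    using assms[of k P i] by (cases "1 \<le> k \<and> k \<le> r") (auto simp: untabulate_def part_k_def)
qed

section \<open>Translation of the index sets and exponents of the theorem into lists\<close>

context
  fixes S :: "'p set" and m :: "'p \<Rightarrow> nat" and al :: "'p \<Rightarrow> nat \<Rightarrow> real"
  assumes S: "finite S" "S \<noteq> {}"
begin

interpretation slope_data "{R. is_data S m R}" "data_n S m" "data_alpha S m al" "data_sigma S m"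
  by (rule data_slope_data[OF S])

lemma bij_betw_part_index:
  assumes R: "is_data S m R"
  shows "bij_betw (\<lambda>(r, I). tabulate (part_k I) r) (part_index S m R) (decomps R)"
proof (rule bij_betwI[where g = "\<lambda>Rs. (length Rs, untabulate Rs)"])
  have iff: "(r, I) \<in> part_index S m R \<longleftrightarrow>
      (\<forall>P i k. k < 1 \<or> r < k \<longrightarrow> I P i k = 0) \<and> tabulate (part_k I) r \<in> decomps R" for r I
    by (auto simp: part_index_def is_partition_iff[OF S(2) R] decomps_def set_tabulate
        simp flip: length_greater_0_conv)
  show "(\<lambda>(r, I). tabulate (part_k I) r) \<in> part_index S m R \<rightarrow> decomps R"
    by (auto simp: iff)
  show "(\<lambda>Rs. (length Rs, untabulate Rs)) \<in> decomps R \<rightarrow> part_index S m R"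
    by (auto simp: iff tabulate_untabulate) (auto simp: untabulate_def)
  show "(\<lambda>Rs. (length Rs, untabulate Rs)) (case p of (r, I) \<Rightarrow> tabulate (part_k I) r) = p"
    if "p \<in> part_index S m R" for p
  proof -
    obtain r I where p: "p = (r, I)" by (cases p)
    from that have "\<forall>P i k. k < 1 \<or> r < k \<longrightarrow> I P i k = 0" unfolding p iff by (rule conjunct1)
    then have "untabulate (tabulate (part_k I) r) = I"
      by (intro untabulate_tabulate) (elim allE impE; assumption)
    then show ?thesis by (simp add: p)
  qed
  show "(case (length Rs, untabulate Rs) of (r, I) \<Rightarrow> tabulate (part_k I) r) = Rs" for Rs
    by (simp add: tabulate_untabulate)
qed

text \<open>The theorem compares neighbouring slopes, \<open>decreasing\<close> all pairs;
  transitivity identifies the two.\<close>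

lemma decreasing_tabulate:
  "decreasing (tabulate x r) \<longleftrightarrow> (\<forall>k\<in>{1..<r}. slope (x k) > slope (x (k + 1)))"
proof -
  have "decreasing (tabulate x r) \<longleftrightarrow> (\<forall>i. Suc i < r \<longrightarrow> slope (x (Suc i)) > slope (x (Suc (Suc i))))"
    by (subst sorted_wrt_iff_nth_Suc_transp) (auto simp: transp_def)
  also have "\<dots> \<longleftrightarrow> (\<forall>k\<in>{1..<r}. slope (x k) > slope (x (k + 1)))"
  proof safe
    fix k assume "\<forall>i. Suc i < r \<longrightarrow> slope (x (Suc i)) > slope (x (Suc (Suc i)))" "k \<in> {1..<r}"
    then show "slope (x k) > slope (x (k + 1))" by (cases k) auto
  qed auto
  finally show ?thesis .
qed

lemma bij_betw_hyp_index:
  assumes R: "is_data S m R"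
  shows "bij_betw (\<lambda>(r, I, ds). tabulate (\<lambda>k. (part_k I k, ds k)) r) (hyp_index S m al R d) (hn (R, d))"
proof (rule bij_betwI[where g = "\<lambda>xs. (length xs, untabulate (map fst xs),
    \<lambda>k. if 1 \<le> k \<and> k \<le> length xs then snd (xs ! (k - 1)) else 0)"])
  let ?f = "\<lambda>r I ds. tabulate (\<lambda>k. (part_k I k, ds k)) r"
  let ?g = "\<lambda>xs. (length xs, untabulate (map fst xs),
    \<lambda>k. if 1 \<le> k \<and> k \<le> length xs then snd (xs ! (k - 1)) else 0)"
  have iff: "(r, I, ds) \<in> hyp_index S m al R d \<longleftrightarrow>
      (\<forall>P i k. k < 1 \<or> r < k \<longrightarrow> I P i k = 0) \<and> (\<forall>k. k < 1 \<or> r < k \<longrightarrow> ds k = 0) \<and>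
      ?f r I ds \<in> hn (R, d)" for r I ds
  proof -
    have total: "sum_list (?f r I ds) = (R, d) \<longleftrightarrow>
        sum_list (tabulate (part_k I) r) = R \<and> (\<Sum>k=1..r. ds k) = d"
      unfolding prod_eq_iff fst_sum_list snd_sum_list map_tabulate o_def fst_conv snd_conv
      by (simp add: sum_list_tabulate)
    have sub: "set (?f r I ds) \<subseteq> E \<longleftrightarrow> (\<forall>k\<in>{1..r}. is_data S m (part_k I k))"
      by (auto simp: set_tabulate E_def)
    have ne: "?f r I ds \<noteq> [] \<longleftrightarrow> 1 \<le> r"
      by (auto simp flip: length_greater_0_conv)
    have dec: "decreasing (?f r I ds) \<longleftrightarrow> (\<forall>k\<in>{1..<r}.
        (real_of_int (ds k) + data_alpha S m al (part_k I k)) / real (data_n S m (part_k I k)) >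
        (real_of_int (ds (k+1)) + data_alpha S m al (part_k I (k+1))) / real (data_n S m (part_k I (k+1))))"
      by (simp only: decreasing_tabulate) (simp only: slope_def deg_def fst_conv snd_conv)
    show ?thesis
      unfolding hyp_index_def hn_def mem_Collect_eq prod.case is_partition_iff[OF S(2) R]
        total sub ne dec
      by (rule iffI; elim conjE; intro conjI; assumption)
  qed
  have inv: "?f (length xs) (untabulate (map fst xs))
      (\<lambda>k. if 1 \<le> k \<and> k \<le> length xs then snd (xs ! (k - 1)) else 0) = xs" for xs
    by (rule nth_equalityI) (simp_all add: part_k_def untabulate_def)
  show "(\<lambda>(r, I, ds). ?f r I ds) \<in> hyp_index S m al R d \<rightarrow> hn (R, d)"
    by (auto simp: iff)
  show "?g \<in> hn (R, d) \<rightarrow> hyp_index S m al R d"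
    unfolding Pi_iff iff inv by (auto simp: untabulate_def)
  show "(case ?g xs of (r, I, ds) \<Rightarrow> ?f r I ds) = xs" for xs
    by (simp only: prod.case inv)
  show "?g (case p of (r, I, ds) \<Rightarrow> ?f r I ds) = p" if p: "p \<in> hyp_index S m al R d" for p
  proof -
    obtain r I ds where "p = (r, I, ds)" by (cases p)
    note z = p[unfolded \<open>p = (r, I, ds)\<close> iff]
    note z1 = z[THEN conjunct1, rule_format] and z2 = z[THEN conjunct2, THEN conjunct1, rule_format]
    have "untabulate (map fst (?f r I ds)) = I"
      unfolding map_tabulate o_def fst_conv by (rule untabulate_tabulate[OF z1])
    moreover have "(\<lambda>k. if 1 \<le> k \<and> k \<le> r then snd (?f r I ds ! (k - 1)) else 0) = ds"
      using z2 by (intro ext) auto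
    ultimately show ?thesis
      unfolding \<open>p = (r, I, ds)\<close> prod.case length_tabulate by (simp only:)
  qed
qed

lemma N_R_eq: "N_R S m r I ds = psum euler (tabulate (\<lambda>k. (part_k I k, ds k)) r)"
proof -
  have "psum euler (tabulate (\<lambda>k. (part_k I k, ds k)) r) =
      psum (\<lambda>x y. (snd x * int (data_n S m (fst y)) - snd y * int (data_n S m (fst x))))
        (tabulate (\<lambda>k. (part_k I k, ds k)) r) - psum (data_sigma S m) (tabulate (part_k I) r)"
    unfolding euler_def psum_diff[symmetric] by (simp add: psum_diff tabulate_def psum_map)
  then show ?thesis
    unfolding N_R_def sigma_R_eq by (simp only: psum_tabulate fst_conv snd_conv)
qed

lemma fls_sums_hyp_index:
  fixes Qd :: "('p \<Rightarrow> nat \<Rightarrow> nat) \<Rightarrow> int \<Rightarrow> rat fls"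
  assumes "((\<lambda>(r, I, ds). fls_X_intpow (N_R S m r I ds) * (\<Prod>k=1..r. Qd (part_k I k) (ds k)))
      has_sum s) (hyp_index S m al R d)" and "is_data S m R"
  shows "fls_sums (weight (\<lambda>(g, d). Qd g d)) (hn (R, d)) s"
  using has_sum_imp_fls_sums[OF assms(1)]
  by (subst fls_sums_bij_betw[OF bij_betw_hyp_index[OF assms(2)]])
    (auto simp: N_R_eq weight_def map_tabulate o_def prod_list_tabulate)

text \<open>The floors in \<open>cut\<close> give \<open>M_R\<close>, and the \<open>+ 1\<close>
  beside each of them adds one \<open>step\<close>, whose total is the last bracket of
  \<open>M'_R\<close>.\<close>

lemma exponent_eq:
  fixes I :: "'p \<Rightarrow> nat \<Rightarrow> nat \<Rightarrow> nat"
  assumes "1 \<le> r" "tabulate (part_k I) r \<in> decomps R"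
  defines "Rs \<equiv> tabulate (part_k I) r"
  shows "cone_exponent d Rs + (\<Sum>k=1..<r. step Rs k * (cut \<mu> Rs k + 1)) =
    M'_R S m R r I d + M_R S m al r I \<mu>"
proof -
  let ?n = "\<lambda>k. int (data_n S m (part_k I k))"
  have range: "{1..r - 1} = {1..<r}" using assms(1) by auto
  have step: "step Rs k = int (data_n S m (part_k I k) + data_n S m (part_k I (k + 1)))"
    if "k \<in> {1..<r}" for k
    using that by (cases k) (simp_all add: step_def Rs_def)
  have le: "sum_list (take k Rs) = part_le I k" if "k \<in> {1..<r}" for k
    using that by (intro ext)
      (simp add: Rs_def take_tabulate sum_list_tabulate part_le_def sum_fun_apply part_k_def)
  have sum_Rs: "sum_list Rs = R" using assms(2) by (simp add: decomps_def Rs_def)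
  then have nR: "int (data_n S m R) = (\<Sum>k=1..r. ?n k)"
    using n_sum_list[of Rs] by (simp add: Rs_def map_tabulate sum_list_tabulate o_def)
  \<comment> \<open>Every part lies beside two cuts except the first and the last.\<close>
  have "(\<Sum>k=1..<r. ?n k + ?n (k + 1)) = 2 * (\<Sum>k=1..r. ?n k) - ?n 1 - ?n r"
    using assms(1)
  proof (induction r rule: dec_induct)
    case (step j)
    then show ?case by simp
  qed simp
  then have steps: "(\<Sum>k=1..<r. step Rs k) = 2 * int (data_n S m R) - ?n 1 - ?n r"
    using step by (simp add: nR)
  have "last Rs = part_k I r"
    using assms(1) by (simp add: Rs_def last_conv_nth flip: length_greater_0_conv)
  moreover have "(\<Sum>k=1..<r. step Rs k * cut \<mu> Rs k) = M_R S m al r I \<mu>"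
    unfolding M_R_def range cut_def by (rule sum.cong[OF refl]) (simp only: step le)
  ultimately show ?thesis
    using sum_Rs steps
    by (simp add: cone_exponent_def M'_R_def sigma_R_eq Rs_def[symmetric] distrib_left sum.distrib)
qed

lemma inversion_part_index:
  fixes Qd :: "('p \<Rightarrow> nat \<Rightarrow> nat) \<Rightarrow> int \<Rightarrow> rat fls" and Q :: "('p \<Rightarrow> nat \<Rightarrow> nat) \<Rightarrow> rat fls"
  assumes hyp: "\<And>R d. is_data S m R \<Longrightarrow>
      ((\<lambda>(r, I, ds). fls_X_intpow (N_R S m r I ds) * (\<Prod>k=1..r. Qd (part_k I k) (ds k)))
         has_sum Q R) (hyp_index S m al R d)"
    and R: "is_data S m R"
  shows "Qd R d =
    (\<Sum>(r, I)\<in>part_index S m R.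
       fls_X_intpow (M'_R S m R r I d
                     + M_R S m al r I ((real_of_int d + data_alpha S m al R) / real (data_n S m R)))
       / (\<Prod>k=1..r-1. fls_X_intpow (int (data_n S m (part_k I k) + data_n S m (part_k I (k+1)))) - 1)
       * (\<Prod>k=1..r. Q (part_k I k)))"
proof -
  let ?\<mu> = "(real_of_int d + data_alpha S m al R) / real (data_n S m R)"
  let ?t = "\<lambda>Rs. fls_X_intpow (cone_exponent d Rs + (\<Sum>k=1..<length Rs. step Rs k * (cut ?\<mu> Rs k + 1))) /
      (\<Prod>k=1..<length Rs. fls_X_intpow (step Rs k) - 1) * prod_list (map Q Rs)"
  have rec: "fls_sums (weight (\<lambda>(g, d). Qd g d)) (hn x) (Q (fst x))" if "x \<in> E" for x
  proof -
    from that have x: "is_data S m (fst x)" by (auto simp: E_def)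
    from fls_sums_hyp_index[OF hyp[OF x] x, of "snd x"] show ?thesis by simp
  qed
  have "slope (R, d) = ?\<mu>" by (simp add: slope_def deg_def)
  then have "Qd R d = sum ?t (decomps R)"
    using inversion_closed_form[OF rec, of R d] R by simp
  also have "\<dots> = (\<Sum>p\<in>part_index S m R. ?t (case p of (r, I) \<Rightarrow> tabulate (part_k I) r))"
    by (rule sum.reindex_bij_betw[OF bij_betw_part_index[OF R], symmetric])
  also have "\<dots> = (\<Sum>(r, I)\<in>part_index S m R.
       fls_X_intpow (M'_R S m R r I d + M_R S m al r I ?\<mu>)
       / (\<Prod>k=1..r-1. fls_X_intpow (int (data_n S m (part_k I k) + data_n S m (part_k I (k+1)))) - 1)
       * (\<Prod>k=1..r. Q (part_k I k)))"
  proof (rule sum.cong[OF refl], clarify)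
    fix r I assume rI: "(r, I) \<in> part_index S m R"
    then have r: "1 \<le> r" by (simp add: part_index_def)
    have dec: "tabulate (part_k I) r \<in> decomps R"
      using bij_betwE[OF bij_betw_part_index[OF R]] rI by fastforce
    have range: "{1..r - 1} = {1..<r}" using r by auto
    have "(\<Prod>k=1..<r. fls_X_intpow (step (tabulate (part_k I) r) k) - 1 :: rat fls) =
        (\<Prod>k=1..r-1. fls_X_intpow (int (data_n S m (part_k I k) + data_n S m (part_k I (k+1)))) - 1)"
      unfolding range
    proof (rule prod.cong[OF refl])
      fix k assume "k \<in> {1..<r}"
      then show "fls_X_intpow (step (tabulate (part_k I) r) k) - 1 =
          fls_X_intpow (int (data_n S m (part_k I k) + data_n S m (part_k I (k + 1)))) - (1 :: rat fls)"
        by (cases k) (simp_all add: step_def)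
    qed
    then show "?t (tabulate (part_k I) r) = fls_X_intpow (M'_R S m R r I d + M_R S m al r I ?\<mu>)
       / (\<Prod>k=1..r-1. fls_X_intpow (int (data_n S m (part_k I k) + data_n S m (part_k I (k+1)))) - 1)
       * (\<Prod>k=1..r. Q (part_k I k))"
      by (simp only: length_tabulate exponent_eq[OF r dec] map_tabulate prod_list_tabulate o_def)
  qed
  finally show ?thesis .
qed

end

unbundle no fps_syntax

theorem theorem5p2:
  fixes S :: "'p set" and m :: "'p \<Rightarrow> nat" and al :: "'p \<Rightarrow> nat \<Rightarrow> real"
    and Qd :: "('p \<Rightarrow> nat \<Rightarrow> nat) \<Rightarrow> int \<Rightarrow> rat fls"
    and Q :: "('p \<Rightarrow> nat \<Rightarrow> nat) \<Rightarrow> rat fls"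
  assumes "finite S" and "S \<noteq> {}" and "weights_ok S m al"
    and hyp: "\<And>R d. is_data S m R \<Longrightarrow>
      ((\<lambda>(r, I, ds). fls_X_intpow (N_R S m r I ds) * (\<Prod>k=1..r. Qd (part_k I k) (ds k)))
         has_sum Q R) (hyp_index S m al R d)"
    and "is_data S m R"
  shows "Qd R d =
    (\<Sum>(r, I)\<in>part_index S m R.
       fls_X_intpow (M'_R S m R r I d
                     + M_R S m al r I ((real_of_int d + data_alpha S m al R) / real (data_n S m R)))
       / (\<Prod>k=1..r-1. fls_X_intpow (int (data_n S m (part_k I k) + data_n S m (part_k I (k+1)))) - 1)
       * (\<Prod>k=1..r. Q (part_k I k)))"
  by (rule inversion_part_index[OF assms(1,2) hyp assms(5)])

end
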